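(* For every $\epsilon>0$ there exists $M(\epsilon)$ such that for all integers $n\ge M(\epsilon)$, \[ -n\, W_{-1}\!\left(-\frac{e^{1-\epsilon}}{n}\right) > p_n > -(n-1)\, W_{-1}\!\left(-\frac{e^{1+\epsilon}}{n-1}\right). \]
   Context: $p_n$ denotes the $n$-th prime. $W_{-1}$ denotes the lower real branch of the Lambert $W$ function: for $y\in[-1/e,0)$, $W_{-1}(y)$ is the unique real solution $w\le -1$ of $w e^{w}=y$. *)

theory Defs
  imports "HOL-Analysis.Analysis" "HOL-Computational_Algebra.Primes" "HOL-Library.Infinite_Set"
begin

text \<open>
  The indexing is 1-based, so \<open>nth_prime 1 = 2\<close>, whereas \<^const>\<open>enumerate\<close> counts from 0.
  The value at 0 is junk (also 2).
\<close>
definition nth_prime :: "nat \<Rightarrow> nat" where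
  "nth_prime n = enumerate {p. prime p} (n - 1)"

text \<open>Only meaningful for \<open>- exp (-1) \<le> y < 0\<close>; see \<open>lambert_Wm1_unique\<close> below.\<close>
definition lambert_Wm1 :: "real \<Rightarrow> real" where
  "lambert_Wm1 y = (THE w. w \<le> -1 \<and> w * exp w = y)"

lemma nth_prime_1: "nth_prime 1 = 2"
proof -
  have "(LEAST p::nat. prime p) = 2"
    by (rule Least_equality) (auto dest: prime_ge_2_nat)
  thus ?thesis by (simp add: nth_prime_def enumerate_0)
qed

lemma nth_prime_Suc:
  assumes "n \<ge> 1"
  shows "nth_prime (Suc n) = (LEAST p. prime p \<and> p > nth_prime n)"
proof -
  obtain m where "n = Suc m" using assms by (cases n) auto
  thus ?thesis
    using enumerate_Suc''[OF primes_infinite, of m] by (simp add: nth_prime_def)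
qed

lemma x_exp_strict_antimono:
  fixes a b :: real
  assumes "a < b" "b \<le> -1"
  shows "b * exp b < a * exp a"
proof (rule DERIV_neg_imp_decreasing_open[OF assms(1), of "\<lambda>w. w * exp w"])
  fix x assume x: "a < x" "x < b"
  have "((\<lambda>w. w * exp w) has_real_derivative (1 + x) * exp x) (at x)"
    by (auto intro!: derivative_eq_intros simp: algebra_simps)
  moreover have "(1 + x) * exp x < 0"
    using x assms by (intro mult_neg_pos) auto
  ultimately show "\<exists>y. ((\<lambda>w. w * exp w) has_real_derivative y) (at x) \<and> y < 0" by blast
qed (auto intro!: continuous_intros)

lemma lambert_Wm1_unique:
  fixes y :: real
  assumes "- exp (-1) \<le> y" "y < 0"
  shows "\<exists>!w. w \<le> -1 \<and> w * exp w = y"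
proof -
  have "((\<lambda>w::real. w * exp w) \<longlongrightarrow> 0) at_bot"
    using tendsto_minus[OF tendsto_power_div_exp_0[of 1]]
    by (simp add: filterlim_at_bot_mirror exp_minus field_simps)
  hence "eventually (\<lambda>w::real. w * exp w > y) at_bot"
    using assms(2) by (rule order_tendstoD)
  then obtain a where a: "\<And>w. w \<le> a \<Longrightarrow> w * exp w > y"
    unfolding eventually_at_bot_linorder by blast
  define c where "c = min a (-1)"
  have "\<exists>x. c \<le> x \<and> x \<le> -1 \<and> x * exp x = y"
    using a[of c] assms(1)
    by (intro IVT2') (auto simp: c_def intro!: continuous_intros)
  moreover have "w = w'" if "w \<le> -1" "w' \<le> -1" "w * exp w = w' * exp w'" for w w' :: real
    using x_exp_strict_antimono[of w w'] x_exp_strict_antimono[of w' w] that by linarith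
  ultimately show ?thesis by metis
qed

lemma lambert_Wm1:
  assumes "- exp (-1) \<le> y" "y < 0"
  shows "lambert_Wm1 y \<le> -1" "lambert_Wm1 y * exp (lambert_Wm1 y) = y"
  using theI'[OF lambert_Wm1_unique[OF assms]] by (auto simp: lambert_Wm1_def)

end

theory Submission
  imports
    Defs
    "HOL-Complex_Analysis.Complex_Analysis"
    "HOL-Number_Theory.Prime_Powers"
    "HOL-Real_Asymp.Real_Asymp"
begin

text \<open>
  By the definition of the Lambert function, the claim is equivalent to
  \<open>\<pi>(x) = x / (ln x - 1 + o(1))\<close> at \<open>x = p\<^sub>n\<close>, hence a consequence of the prime number theorem in
  the form \<open>\<pi>(x) = x / ln x + x / ln\<^sup>2 x + O(x / ln\<^sup>3 x)\<close>.

  The latter is obtained by a quantitative version of Newman's contour argument. Put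
  \<open>Z(s) = (s - 1) \<zeta>(s)\<close> and fix a small \<open>\<delta> > 0\<close>. For \<open>Re s \<ge> 1 - \<delta>\<close> and \<open>t = Im s\<close> large,
  \<open>Z(s) = O(|t| powr (1 + \<delta>))\<close>; by Cauchy's inequality the same holds for \<open>Z'\<close>, and the inequality
  \<open>3 + 4 cos \<phi> + cos 2\<phi> \<ge> 0\<close> yields a lower bound for \<open>|Z|\<close> just right of the line \<open>Re s = 1\<close>.
  Together, these give a zero-free region of width \<open>\<kappa> |t| powr (- 5 \<delta>)\<close> left of that line in which
  \<open>\<zeta>'/\<zeta>\<close> is \<open>O(|t| powr (5 \<delta>))\<close>. Taking the radius of the contour for \<open>\<Sum>n\<le>N. (\<Lambda>(n) - 1) / n\<close> to be
  \<open>ln\<^sup>3 N\<close> and \<open>5 \<delta> = 1 / 4\<close> shows that this sum is \<open>c + O(1 / ln\<^sup>2 N)\<close>, and summation by parts does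
  the rest.
\<close>

section \<open>Dirichlet series\<close>

lemma norm_of_nat_powr: "norm (of_nat n powr s :: complex) = real n powr Re s"
  by (subst norm_powr_real_powr) auto

lemma of_nat_mult_powr:
  "(of_nat (m * n) :: complex) powr z = of_nat m powr z * of_nat n powr z"
  using powr_times_real[of "of_nat m" "of_nat n" z] by simp

lemma has_field_derivative_of_nat_powr_minus:
  "((\<lambda>s::complex. of_nat n powr (-s)) has_field_derivative
      - of_real (ln (real n)) * of_nat n powr (-s)) (at s)"
  by (cases "n = 0") (auto intro!: derivative_eq_intros simp: powr_def Ln_of_nat)

text \<open>The coefficient \<open>a 0\<close> never matters, since \<open>0 powr z = 0\<close> for all \<open>z\<close>.\<close>
definition dirichlet :: "(nat \<Rightarrow> complex) \<Rightarrow> complex \<Rightarrow> complex" where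
  "dirichlet a s = (\<Sum>n. a n * of_nat n powr (-s))"

definition abs_conv_abscissa_le :: "(nat \<Rightarrow> complex) \<Rightarrow> real \<Rightarrow> bool" where
  "abs_conv_abscissa_le a c \<longleftrightarrow> (\<forall>\<sigma>>c. summable (\<lambda>n. norm (a n) * real n powr (-\<sigma>)))"

lemma summable_norm_dirichlet:
  assumes "abs_conv_abscissa_le a c" "Re s > c"
  shows   "summable (\<lambda>n. norm (a n * of_nat n powr (-s)))"
  using assms by (simp add: abs_conv_abscissa_le_def norm_mult norm_of_nat_powr)

lemma sums_dirichlet:
  assumes "abs_conv_abscissa_le a c" "Re s > c"
  shows   "(\<lambda>n. a n * of_nat n powr (-s)) sums dirichlet a s"
  unfolding dirichlet_def
  by (intro summable_sums summable_norm_cancel[OF summable_norm_dirichlet[OF assms]])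

lemma abs_conv_abscissa_le_comparison:
  assumes "abs_conv_abscissa_le b c" "\<And>n. n > 0 \<Longrightarrow> norm (a n) \<le> norm (b n)"
  shows   "abs_conv_abscissa_le a c"
  unfolding abs_conv_abscissa_le_def
proof (intro allI impI)
  fix \<sigma> :: real assume "\<sigma> > c"
  hence "summable (\<lambda>n. norm (b n) * real n powr (-\<sigma>))"
    using assms(1) by (simp add: abs_conv_abscissa_le_def)
  moreover have "norm (norm (a n) * real n powr (-\<sigma>)) \<le> norm (b n) * real n powr (-\<sigma>)" for n
    using assms(2)[of n] by (cases "n = 0") (auto intro!: mult_right_mono)
  ultimately show "summable (\<lambda>n. norm (a n) * real n powr (-\<sigma>))"
    by (rule summable_comparison_test'[where N = 0])
qed

lemma abs_conv_abscissa_le_const: "abs_conv_abscissa_le (\<lambda>_. c) 1"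
  by (auto simp: abs_conv_abscissa_le_def summable_real_powr_iff intro!: summable_mult)

lemma abs_conv_abscissa_le_ln:
  assumes "abs_conv_abscissa_le a c"
  shows   "abs_conv_abscissa_le (\<lambda>n. of_real (ln (real n)) * a n) c"
  unfolding abs_conv_abscissa_le_def
proof (intro allI impI)
  fix \<sigma> :: real assume \<sigma>: "\<sigma> > c"
  define \<delta> where "\<delta> = (\<sigma> - c) / 2"
  have \<delta>: "\<delta> > 0" "\<sigma> - \<delta> > c" using \<sigma> by (auto simp: \<delta>_def field_simps)
  have "summable (\<lambda>n. 1 / \<delta> * (norm (a n) * real n powr (-(\<sigma> - \<delta>))))"
    using assms \<delta> by (intro summable_mult) (simp only: abs_conv_abscissa_le_def)
  thus "summable (\<lambda>n. norm (of_real (ln (real n)) * a n) * real n powr (-\<sigma>))"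
  proof (rule summable_comparison_test'[where N = 1])
    fix n :: nat assume n: "n \<ge> 1"
    have "ln (real n) * real n powr (-\<sigma>) \<le> real n powr \<delta> / \<delta> * real n powr (-\<sigma>)"
      using n \<delta> by (intro mult_right_mono ln_powr_bound) auto
    also have "\<dots> = 1 / \<delta> * real n powr (-(\<sigma> - \<delta>))" by (simp flip: powr_add)
    finally have "norm (a n) * (ln (real n) * real n powr (-\<sigma>)) \<le>
        norm (a n) * (1 / \<delta> * real n powr (-(\<sigma> - \<delta>)))"
      by (intro mult_left_mono) auto
    thus "norm (norm (of_real (ln (real n)) * a n) * real n powr (-\<sigma>)) \<le>
        1 / \<delta> * (norm (a n) * real n powr (-(\<sigma> - \<delta>)))"
      using n by (simp add: norm_mult mult_ac)
  qed
qed

lemma has_field_derivative_dirichlet: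
  assumes a: "abs_conv_abscissa_le a c" and s: "Re s > c"
  shows   "(dirichlet a has_field_derivative - dirichlet (\<lambda>n. of_real (ln (real n)) * a n) s) (at s)"
proof -
  define \<sigma> where "\<sigma> = (Re s + c) / 2"
  define S where "S = {s. Re s > \<sigma>}"
  define f where "f = (\<lambda>n z. a n * of_nat n powr (-z))"
  define f' where "f' = (\<lambda>n z. - (of_real (ln (real n)) * a n * of_nat n powr (-z)))"
  have \<sigma>: "c < \<sigma>" and "s \<in> S" using s by (auto simp: \<sigma>_def S_def)
  have "open S" by (simp add: S_def open_halfspace_Re_gt)
  have deriv: "(f n has_field_derivative f' n z) (at z)" for n z
    using DERIV_cmult[OF has_field_derivative_of_nat_powr_minus[of n z], of "a n"]
    by (simp add: f_def f'_def mult_ac)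
  have bound: "norm (f n z) \<le> norm (a n) * real n powr (-\<sigma>)" if "z \<in> S" for n z
    using that unfolding f_def norm_mult norm_of_nat_powr S_def
    by (cases "n = 0") (auto intro!: mult_left_mono powr_mono)
  have summable: "summable (\<lambda>n. norm (a n) * real n powr (-\<sigma>))"
    using a \<sigma> by (simp add: abs_conv_abscissa_le_def)
  obtain g g' where g: "\<forall>z\<in>S.
      (\<lambda>n. f n z) sums g z \<and> (\<lambda>n. f' n z) sums g' z \<and> (g has_field_derivative g' z) (at z)"
    by (rule series_and_derivative_comparison[OF \<open>open S\<close> summable deriv])
       (auto intro!: always_eventually bound)
  have g_eq: "g z = dirichlet a z" if "z \<in> S" for z
    using g that by (simp add: f_def dirichlet_def sums_iff)
  have "g' s = - dirichlet (\<lambda>n. of_real (ln (real n)) * a n) s"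
    using g \<open>s \<in> S\<close> sums_minus[of "\<lambda>n. f' n s" "g' s"]
    by (simp add: f'_def dirichlet_def sums_iff)
  with bspec[OF g \<open>s \<in> S\<close>] have
    "(g has_field_derivative - dirichlet (\<lambda>n. of_real (ln (real n)) * a n) s) (at s)" by simp
  thus ?thesis
    by (rule has_field_derivative_transform_within_open[OF _ \<open>open S\<close> \<open>s \<in> S\<close> g_eq])
qed

lemma has_sum_product:
  fixes f :: "'a \<Rightarrow> 'c :: {real_normed_field, banach, second_countable_topology}" and g :: "'b \<Rightarrow> 'c"
  assumes f: "(\<lambda>x. norm (f x)) summable_on A" and g: "(\<lambda>y. norm (g y)) summable_on B"
  shows   "((\<lambda>(x, y). f x * g y) has_sum infsum f A * infsum g B) (A \<times> B)"
proof (rule has_sum_SigmaI)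
  have "(\<lambda>z. norm (case z of (x, y) \<Rightarrow> f x * g y)) summable_on A \<times> B"
    unfolding Infinite_Sum.abs_summable_on_Sigma_iff
  proof (intro conjI ballI)
    show "(\<lambda>y. norm (case (x, y) of (x, y) \<Rightarrow> f x * g y)) summable_on B" for x
      using summable_on_cmult_right[OF g] by (simp add: norm_mult)
    show "(\<lambda>x. norm (\<Sum>\<^sub>\<infinity>y\<in>B. norm (case (x, y) of (x, y) \<Rightarrow> f x * g y))) summable_on A"
      using summable_on_cmult_left[OF f]
      by (simp add: norm_mult infsum_cmult_right' infsum_nonneg abs_mult)
  qed
  thus "(\<lambda>(x, y). f x * g y) summable_on A \<times> B" by (rule abs_summable_summable)
  show "((\<lambda>y. case (x, y) of (x, y) \<Rightarrow> f x * g y) has_sum f x * infsum g B) B" for x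
    by (simp add: has_sum_cmult_right has_sum_infsum abs_summable_summable[OF g])
  show "((\<lambda>x. f x * infsum g B) has_sum infsum f A * infsum g B) A"
    by (intro has_sum_cmult_left has_sum_infsum abs_summable_summable[OF f])
qed

lemma has_sum_dirichlet:
  assumes "abs_conv_abscissa_le a c" "Re s > c"
  shows   "((\<lambda>n. a n * of_nat n powr (-s)) has_sum dirichlet a s) {0<..}"
proof -
  have "((\<lambda>n. a n * of_nat n powr (-s)) has_sum dirichlet a s) UNIV"
    by (intro norm_summable_imp_has_sum summable_norm_dirichlet[OF assms] sums_dirichlet[OF assms])
  also have "?this \<longleftrightarrow> ?thesis"
    by (rule has_sum_cong_neutral) auto
  finally show ?thesis .
qed

lemma dirichlet_mult:
  assumes a: "abs_conv_abscissa_le a c" and b: "abs_conv_abscissa_le b c" and s: "Re s > c"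
  shows   "dirichlet a s * dirichlet b s = dirichlet (\<lambda>n. \<Sum>d | d dvd n. a d * b (n div d)) s"
proof -
  define f where "f = (\<lambda>a n. a n * of_nat n powr (-s) :: complex)"
  have f: "(f a has_sum dirichlet a s) {0<..}" if "abs_conv_abscissa_le a c" for a
    using has_sum_dirichlet[OF that s] by (simp add: f_def)
  have abs_f: "(\<lambda>n. norm (f a n)) summable_on {0<..}" if "abs_conv_abscissa_le a c" for a
  proof (rule summable_on_subset_banach)
    show "(\<lambda>n. norm (f a n)) summable_on UNIV"
      using summable_norm_dirichlet[OF that s] by (simp add: f_def summable_on_UNIV_nonneg_real_iff)
  qed simp
  have "((\<lambda>(d, m). f a d * f b m) has_sum dirichlet a s * dirichlet b s) ({0<..} \<times> {0<..})"
    using has_sum_product[OF abs_f[OF a] abs_f[OF b]] by (simp add: infsumI[OF f] a b)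
  also have "?this \<longleftrightarrow> ((\<lambda>(n, d). a d * b (n div d) * of_nat n powr (-s)) has_sum
      dirichlet a s * dirichlet b s) (SIGMA n:{0<..}. {d. d dvd n})"
  proof (rule has_sum_reindex_bij_witness[of _ "\<lambda>(n, d). (d, n div d)" "\<lambda>(d, m). (d * m, d)"])
    fix x :: "nat \<times> nat" assume "x \<in> {0<..} \<times> {0<..}"
    thus "(case case x of (d, m) \<Rightarrow> (d * m, d) of (n, d) \<Rightarrow> a d * b (n div d) * of_nat n powr (-s)) =
          (case x of (d, m) \<Rightarrow> f a d * f b m)"
      by (cases x) (simp add: f_def of_nat_mult_powr del: of_nat_mult)
  qed (auto simp: dvd_div_eq_0_iff intro: Nat.gr0I)
  finally have "((\<lambda>n. (\<Sum>d | d dvd n. a d * b (n div d)) * of_nat n powr (-s)) has_sum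
      dirichlet a s * dirichlet b s) {0<..}"
  proof (rule has_sum_SigmaD)
    fix n :: nat assume "n \<in> {0<..}"
    hence "finite {d. d dvd n}" by simp
    thus "((\<lambda>d. case (n, d) of (n, d) \<Rightarrow> a d * b (n div d) * of_nat n powr (-s)) has_sum
        (\<Sum>d | d dvd n. a d * b (n div d)) * of_nat n powr (-s)) {d. d dvd n}"
      by (intro has_sum_finiteI) (simp_all add: sum_distrib_right)
  qed
  also have "?this \<longleftrightarrow> ((\<lambda>n. (\<Sum>d | d dvd n. a d * b (n div d)) * of_nat n powr (-s)) has_sum
      dirichlet a s * dirichlet b s) UNIV"
    by (rule has_sum_cong_neutral) auto
  finally show ?thesis
    unfolding dirichlet_def by (auto dest!: has_sum_imp_sums simp: sums_iff)
qed

lemma dirichlet_tendsto_at_top: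
  assumes "abs_conv_abscissa_le a c"
  shows   "((\<lambda>\<sigma>. dirichlet a (of_real \<sigma>)) \<longlongrightarrow> a 1) at_top"
proof -
  have "((\<lambda>\<sigma>. a n * of_nat n powr (- of_real \<sigma>)) \<longlongrightarrow> (if n = 1 then a n else 0)) at_top" for n
  proof (cases "n \<le> 1")
    case False
    have "((\<lambda>\<sigma>. norm (a n) * real n powr (-\<sigma>)) \<longlongrightarrow> 0) at_top"
      using False by real_asymp
    hence "((\<lambda>\<sigma>. norm (a n * of_nat n powr (- of_real \<sigma>))) \<longlongrightarrow> 0) at_top"
      by (simp add: norm_mult norm_of_nat_powr)
    thus ?thesis using False by (simp add: tendsto_norm_zero_iff)
  qed (auto simp: le_Suc_eq)
  moreover have "\<forall>\<^sub>F (n, \<sigma>) in at_top \<times>\<^sub>F at_top.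
      norm (a n * of_nat n powr (- of_real \<sigma>)) \<le> norm (a n) * real n powr (-(c + 1))"
    using eventually_prodI[OF eventually_gt_at_top[of 0] eventually_ge_at_top[of "c + 1"]]
    by eventually_elim (auto simp: norm_mult norm_of_nat_powr intro!: mult_left_mono powr_mono)
  moreover have "summable (\<lambda>n. norm (a n) * real n powr (-(c + 1)))"
    using assms unfolding abs_conv_abscissa_le_def by (metis less_add_one)
  ultimately have "((\<lambda>\<sigma>. dirichlet a (of_real \<sigma>)) \<longlongrightarrow> (\<Sum>n. if n = 1 then a n else 0)) at_top"
    unfolding dirichlet_def by (intro tannerys_theorem[THEN conjunct2, THEN conjunct2]) auto
  thus ?thesis using sums_single[of 1 a] by (simp add: sums_iff)
qed

section \<open>The zeta function to the right of the line \<open>Re s = 1\<close>\<close>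

definition zeta :: "complex \<Rightarrow> complex" where
  "zeta = dirichlet (\<lambda>_. 1)"

lemma sums_zeta: "Re s > 1 \<Longrightarrow> (\<lambda>n. of_nat n powr (-s)) sums zeta s"
  using sums_dirichlet[OF abs_conv_abscissa_le_const, of s 1] by (simp add: zeta_def)

lemma abs_conv_abscissa_le_mangoldt: "abs_conv_abscissa_le mangoldt 1"
  by (rule abs_conv_abscissa_le_comparison
             [OF abs_conv_abscissa_le_ln[OF abs_conv_abscissa_le_const[of 1]]])
     (use mangoldt_le in auto)

lemma has_field_derivative_zeta:
  assumes "Re s > 1"
  shows   "(zeta has_field_derivative - (dirichlet mangoldt s * zeta s)) (at s)"
proof -
  have "dirichlet mangoldt s * zeta s = dirichlet (\<lambda>n. \<Sum>d | d dvd n. mangoldt d) s"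
    using dirichlet_mult[OF abs_conv_abscissa_le_mangoldt abs_conv_abscissa_le_const assms]
    by (simp add: zeta_def)
  also have "\<dots> = dirichlet (\<lambda>n. of_real (ln (real n))) s"
    unfolding dirichlet_def
  proof (intro suminf_cong)
    show "(\<Sum>d | d dvd n. mangoldt d) * of_nat n powr (-s) =
        of_real (ln (real n)) * of_nat n powr (-s)"
      for n by (cases "n = 0") (simp_all add: mangoldt_sum)
  qed
  finally show ?thesis
    using has_field_derivative_dirichlet[OF abs_conv_abscissa_le_const assms, of 1]
    by (simp add: zeta_def)
qed

text \<open>For \<open>n \<le> 1\<close> the coefficient is \<open>0 / 0 = 0\<close>.\<close>
definition log_zeta :: "complex \<Rightarrow> complex" where
  "log_zeta = dirichlet (\<lambda>n. of_real (mangoldt n / ln (real n)))"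

lemma abs_conv_abscissa_le_log_zeta: "abs_conv_abscissa_le (\<lambda>n. of_real (mangoldt n / ln (real n))) 1"
proof (rule abs_conv_abscissa_le_comparison[OF abs_conv_abscissa_le_const[of 1]])
  show "norm (of_real (mangoldt n / ln (real n)) :: complex) \<le> norm (1 :: complex)" if "n > 0" for n
    using that mangoldt_le[of n] mangoldt_nonneg[of n]
    by (cases "n = 1") (auto simp: norm_divide divide_simps)
qed

lemma has_field_derivative_log_zeta:
  assumes "Re s > 1"
  shows   "(log_zeta has_field_derivative - dirichlet mangoldt s) (at s)"
proof -
  have "of_real (ln (real n)) * of_real (mangoldt n / ln (real n)) = (mangoldt n :: complex)" for n
    by (cases "n \<le> 1") (auto simp: le_Suc_eq)
  thus ?thesis
    using has_field_derivative_dirichlet[OF abs_conv_abscissa_le_log_zeta assms]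
    by (simp only: log_zeta_def)
qed

lemma zeta_eq_exp_log_zeta:
  assumes "Re s > 1"
  shows   "zeta s = exp (log_zeta s)"
proof -
  have "\<exists>c. \<forall>s\<in>{s. Re s > 1}. zeta s * exp (- log_zeta s) = c"
  proof (rule has_field_derivative_zero_constant[OF convex_halfspace_Re_gt])
    fix s assume "s \<in> {s. Re s > 1}"
    hence s: "Re s > 1" by simp
    show "((\<lambda>s. zeta s * exp (- log_zeta s)) has_field_derivative 0) (at s within {s. Re s > 1})"
      by (rule has_field_derivative_at_within)
         (auto intro!: derivative_eq_intros has_field_derivative_zeta[OF s]
                       has_field_derivative_log_zeta[OF s])
  qed
  then obtain c where c: "\<And>s. Re s > 1 \<Longrightarrow> zeta s * exp (- log_zeta s) = c" by auto
  have "((\<lambda>\<sigma>. zeta (of_real \<sigma>) * exp (- log_zeta (of_real \<sigma>))) \<longlongrightarrow> 1 * exp (-0)) at_top"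
    using dirichlet_tendsto_at_top[OF abs_conv_abscissa_le_const, of 1]
          dirichlet_tendsto_at_top[OF abs_conv_abscissa_le_log_zeta]
    by (intro tendsto_intros) (simp_all add: zeta_def log_zeta_def)
  moreover have "\<forall>\<^sub>F \<sigma> in at_top. zeta (of_real \<sigma>) * exp (- log_zeta (of_real \<sigma>)) = c"
    using eventually_gt_at_top[of 1] by eventually_elim (auto intro: c)
  ultimately have "((\<lambda>_. c) \<longlongrightarrow> 1) (at_top :: real filter)"
    by (simp add: tendsto_cong)
  hence "c = 1" by (simp add: tendsto_const_iff)
  thus ?thesis using c[OF assms] by (simp add: exp_minus field_simps)
qed

lemma Re_dirichlet_of_real_sums:
  fixes a :: "nat \<Rightarrow> real"
  assumes "abs_conv_abscissa_le (\<lambda>n. of_real (a n)) c" "\<sigma> > c"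
  shows   "(\<lambda>n. a n * real n powr (-\<sigma>) * cos (t * ln (real n))) sums
             Re (dirichlet (\<lambda>n. of_real (a n)) (Complex \<sigma> t))"
proof -
  have "Re (of_real (a n) * of_nat n powr (- Complex \<sigma> t)) =
      a n * real n powr (-\<sigma>) * cos (t * ln (real n))" for n
    by (cases "n = 0") (simp_all add: powr_def Ln_of_nat Re_exp mult_ac)
  thus ?thesis
    using sums_Re[OF sums_dirichlet[OF assms(1), of "Complex \<sigma> t"]] assms(2)
    by (simp del: times_complex.sel)
qed

text \<open>The inequality \<open>3 + 4 cos \<phi> + cos 2\<phi> = 2 (1 + cos \<phi>)\<^sup>2 \<ge> 0\<close>, applied to every term of the series.\<close>
lemma Re_dirichlet_341_nonneg:
  fixes a :: "nat \<Rightarrow> real"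
  assumes "abs_conv_abscissa_le (\<lambda>n. of_real (a n)) c" "\<sigma> > c" "\<And>n. a n \<ge> 0"
  defines "f \<equiv> dirichlet (\<lambda>n. of_real (a n))"
  shows   "3 * Re (f (Complex \<sigma> 0)) + 4 * Re (f (Complex \<sigma> t)) + Re (f (Complex \<sigma> (2 * t))) \<ge> 0"
proof -
  define b where "b = (\<lambda>n. a n * real n powr (-\<sigma>))"
  have "(\<lambda>n. 3 * (b n * cos (0 * ln (real n))) + 4 * (b n * cos (t * ln (real n))) +
           b n * cos (2 * t * ln (real n))) sums
        (3 * Re (f (Complex \<sigma> 0)) + 4 * Re (f (Complex \<sigma> t)) + Re (f (Complex \<sigma> (2 * t))))"
    unfolding b_def f_def by (intro sums_add sums_mult Re_dirichlet_of_real_sums[OF assms(1,2)])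
  moreover have "3 * (b n * cos (0 * ln (real n))) + 4 * (b n * cos (t * ln (real n))) +
           b n * cos (2 * t * ln (real n)) \<ge> 0" for n
  proof -
    have "cos (2 * t * ln (real n)) = 2 * cos (t * ln (real n)) ^ 2 - 1"
      using cos_double_cos[of "t * ln (real n)"] by (simp add: mult.assoc)
    hence "3 * (b n * cos (0 * ln (real n))) + 4 * (b n * cos (t * ln (real n))) +
           b n * cos (2 * t * ln (real n)) = 2 * b n * (1 + cos (t * ln (real n))) ^ 2"
      by (simp only:) (simp add: power2_eq_square algebra_simps)
    thus ?thesis using assms(3) by (simp add: b_def)
  qed
  ultimately show ?thesis by (rule sums_le[OF _ sums_zero, rotated])
qed

lemma norm_zeta_341_ge:
  assumes "\<sigma> > 1"
  shows   "1 \<le> norm (zeta (of_real \<sigma>)) ^ 3 * norm (zeta (Complex \<sigma> t)) ^ 4 *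
                norm (zeta (Complex \<sigma> (2 * t)))"
proof -
  have "mangoldt n / ln (real n) \<ge> 0" for n
    by (cases "n = 0") (auto intro!: divide_nonneg_nonneg mangoldt_nonneg)
  hence "1 \<le> exp (3 * Re (log_zeta (Complex \<sigma> 0)) + 4 * Re (log_zeta (Complex \<sigma> t)) +
                 Re (log_zeta (Complex \<sigma> (2 * t))))"
    using Re_dirichlet_341_nonneg[OF abs_conv_abscissa_le_log_zeta assms, of t]
    by (simp add: log_zeta_def)
  thus ?thesis
    using assms
    by (simp add: zeta_eq_exp_log_zeta complex_of_real_def exp_add flip: exp_of_nat_mult)
qed

section \<open>Estimates for sums of powers\<close>

lemma sum_antimono_le_antiderivative:
  fixes h \<phi> :: "real \<Rightarrow> real"
  assumes deriv: "\<And>x. real N \<le> x \<Longrightarrow> (\<phi> has_real_derivative h x) (at x)"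
  assumes anti: "\<And>x y. real N \<le> x \<Longrightarrow> x \<le> y \<Longrightarrow> h y \<le> h x" and "N \<le> M"
  shows   "(\<Sum>n\<in>{N<..M}. h (real n)) \<le> \<phi> (real M) - \<phi> (real N)"
  using \<open>N \<le> M\<close>
proof (induction M rule: dec_induct)
  case (step M)
  obtain z where z: "real M < z" "z < real (Suc M)" "\<phi> (real (Suc M)) - \<phi> (real M) = h z"
    using MVT2[of "real M" "real (Suc M)" \<phi> h] deriv step by auto
  have "h (real (Suc M)) \<le> h z" using z step by (intro anti) auto
  moreover have "{N<..Suc M} = insert (Suc M) {N<..M}" using step by auto
  ultimately show ?case using step.IH z(3) by simp
qed auto

lemma sum_mono_le_antiderivative:
  fixes h \<phi> :: "real \<Rightarrow> real"
  assumes deriv: "\<And>x. real N \<le> x \<Longrightarrow> (\<phi> has_real_derivative h x) (at x)"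
  assumes mono: "\<And>x y. real N \<le> x \<Longrightarrow> x \<le> y \<Longrightarrow> h x \<le> h y" and "N \<le> M"
  shows   "(\<Sum>n=N..<M. h (real n)) \<le> \<phi> (real M) - \<phi> (real N)"
  using \<open>N \<le> M\<close>
proof (induction M rule: dec_induct)
  case (step M)
  obtain z where z: "real M < z" "z < real (Suc M)" "\<phi> (real (Suc M)) - \<phi> (real M) = h z"
    using MVT2[of "real M" "real (Suc M)" \<phi> h] deriv step by auto
  have "h (real M) \<le> h z" using z step by (intro mono) auto
  thus ?case using step z(3) by simp
qed auto

lemma sum_powr_le:
  assumes "0 < y"
  shows   "(\<Sum>n\<le>N. real n powr (y - 1)) \<le> real N powr y / y + real N powr (y - 1)"
proof (cases "N = 0")
  case N: False
  have deriv: "((\<lambda>x. x powr y / y) has_real_derivative x powr (y - 1)) (at x)" if "real 1 \<le> x" for x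
    using that assms by (auto intro!: derivative_eq_intros)
  have "{..N} = insert 0 (insert 1 {1<..N})" using N by auto
  hence split_first: "(\<Sum>n\<le>N. real n powr (y - 1)) = 1 + (\<Sum>n\<in>{1<..N}. real n powr (y - 1))" by simp
  have "{..N} = insert 0 (insert N {1..<N})" using N by auto
  hence split_last: "(\<Sum>n\<le>N. real n powr (y - 1)) =
      real N powr (y - 1) + (\<Sum>n=1..<N. real n powr (y - 1))"
    using N by simp
  show ?thesis
  proof (cases "y \<le> 1")
    case True
    have "(\<Sum>n\<in>{1<..N}. real n powr (y - 1)) \<le> real N powr y / y - real 1 powr y / y"
      using N True by (intro sum_antimono_le_antiderivative deriv powr_mono2') auto
    moreover have "1 \<le> 1 / y" using True assms by simp
    ultimately have "(\<Sum>n\<le>N. real n powr (y - 1)) \<le> real N powr y / y" unfolding split_first by simp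
    thus ?thesis by (simp add: add_increasing2)
  next
    case False
    have "(\<Sum>n=1..<N. real n powr (y - 1)) \<le> real N powr y / y - real 1 powr y / y"
      using N False by (intro sum_mono_le_antiderivative deriv powr_mono2) auto
    moreover have "0 \<le> 1 / y" using assms by simp
    ultimately show ?thesis unfolding split_last by (simp del: zero_le_divide_1_iff)
  qed
qed auto

lemma sum_powr_neg_le:
  assumes "0 < \<delta>" "\<delta> \<le> 1" "1 - \<delta> \<le> \<sigma>" "0 < N"
  shows   "(\<Sum>n\<le>N. real n powr (-\<sigma>)) \<le> 2 / \<delta> * real N powr \<delta>"
proof -
  have "(\<Sum>n\<le>N. real n powr (-\<sigma>)) \<le> (\<Sum>n\<le>N. real n powr (\<delta> - 1))"
  proof (rule sum_mono)
    show "real n powr (-\<sigma>) \<le> real n powr (\<delta> - 1)" for n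
      using assms by (cases "n = 0") (auto intro!: powr_mono)
  qed
  also have "\<dots> \<le> real N powr \<delta> / \<delta> + real N powr (\<delta> - 1)" by (rule sum_powr_le[OF assms(1)])
  also have "\<dots> \<le> real N powr \<delta> / \<delta> + real N powr \<delta> / \<delta>"
  proof (rule add_left_mono)
    have "real N powr (\<delta> - 1) \<le> real N powr \<delta> * 1" using assms by (simp add: powr_mono)
    also have "\<dots> \<le> real N powr \<delta> * (1 / \<delta>)" using assms by (intro mult_left_mono) auto
    finally show "real N powr (\<delta> - 1) \<le> real N powr \<delta> / \<delta>" by simp
  qed
  finally show ?thesis by simp
qed

lemma powr_double_le:
  assumes "t \<ge> 0" "a \<le> real k"
  shows   "(2 * t) powr a \<le> 2 ^ k * t powr a"
proof -
  have "(2 * t) powr a = 2 powr a * t powr a" using assms(1) by (simp add: powr_mult)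
  also have "\<dots> \<le> 2 powr real k * t powr a" using assms(2) by (intro mult_right_mono powr_mono) auto
  finally show ?thesis by (simp add: powr_realpow)
qed

lemma mult_powr_minus_le:
  fixes \<kappa> t \<theta> :: real
  assumes "0 \<le> \<kappa>" "1 \<le> t" "0 \<le> \<theta>"
  shows   "\<kappa> * t powr (-\<theta>) \<le> \<kappa>"
proof -
  have "t powr (-\<theta>) \<le> t powr 0" using assms by (intro powr_mono) auto
  thus ?thesis using assms mult_left_mono[of "t powr (-\<theta>)" 1 \<kappa>] by simp
qed

lemma sum_powr_tail_le:
  assumes "0 < y" "0 < N"
  shows   "(\<Sum>n\<in>{N..<M}. real n powr (-y - 1)) \<le> real N powr (-y - 1) + real N powr (-y) / y"
proof (cases "N < M")
  case True
  have "(\<Sum>n\<in>{N<..M - 1}. real n powr (-y - 1)) \<le>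
      - (real (M - 1) powr (-y) / y) - - (real N powr (-y) / y)"
    using True assms
    by (intro sum_antimono_le_antiderivative) (auto intro!: derivative_eq_intros powr_mono2')
  moreover have "0 \<le> real (M - 1) powr (-y) / y" using assms by simp
  moreover have "{N..<M} = insert N {N<..M - 1}" using True by auto
  ultimately show ?thesis by simp
qed (use assms in auto)

lemma has_vector_derivative_of_real_powr:
  fixes c :: complex
  assumes "x > 0"
  shows   "((\<lambda>x. of_real x powr c) has_vector_derivative c * of_real x powr (c - 1)) (at x)"
proof -
  have "((\<lambda>z. z powr c) has_field_derivative c * of_real x powr (c - 1)) (at (of_real x))"
    using assms by (intro has_field_derivative_powr) (auto simp: complex_nonpos_Reals_iff)
  thus ?thesis by (rule has_vector_derivative_real_field)
qed

lemma norm_diff_le_vector_derivative: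
  fixes f :: "real \<Rightarrow> 'a :: real_normed_vector"
  assumes "a \<le> b"
  assumes deriv: "\<And>x. a \<le> x \<Longrightarrow> x \<le> b \<Longrightarrow> (f has_vector_derivative f' x) (at x)"
  assumes bound: "\<And>x. a \<le> x \<Longrightarrow> x \<le> b \<Longrightarrow> norm (f' x) \<le> B"
  shows   "norm (f b - f a) \<le> B * (b - a)"
proof (cases "a < b")
  case True
  have "norm (f b - f a) \<le> B * b - B * a"
  proof (rule differentiable_bound_general[OF True, where f' = f'])
    show "continuous_on {a..b} f"
      by (intro continuous_at_imp_continuous_on ballI has_vector_derivative_continuous[OF deriv]) auto
    show "((\<lambda>x. B * x) has_vector_derivative B) (at x)" for x
      by (auto intro!: derivative_eq_intros simp flip: has_real_derivative_iff_has_vector_derivative)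
  qed (use deriv bound in \<open>auto intro!: continuous_intros\<close>)
  thus ?thesis by (simp add: algebra_simps)
qed (use assms(1) in auto)

lemma norm_of_real_powr_diff_le:
  assumes "0 < a" "a \<le> x" "Re s \<ge> 0"
  shows   "norm (of_real x powr (-s) - of_real a powr (-s) :: complex) \<le>
             norm s * a powr (-Re s - 1) * (x - a)"
proof (rule norm_diff_le_vector_derivative[OF assms(2)])
  fix u assume u: "a \<le> u" "u \<le> x"
  show "((\<lambda>u. of_real u powr (-s)) has_vector_derivative -s * of_real u powr (-s - 1)) (at u)"
    using u assms by (intro has_vector_derivative_of_real_powr) auto
  show "norm (-s * of_real u powr (-s - 1) :: complex) \<le> norm s * a powr (-Re s - 1)"
    using u assms by (auto simp: norm_mult norm_powr_real_powr intro!: mult_left_mono powr_mono2')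
qed

section \<open>The function \<open>(s - 1) \<zeta>(s)\<close>\<close>

text \<open>
  For \<open>n > 0\<close> this is \<open>s - 1\<close> times the integral of \<open>n powr (-s) - x powr (-s)\<close> over \<open>n \<le> x \<le> n + 1\<close>, so
  the sum over \<open>n\<close> converges for \<open>Re s > 0\<close>. As \<open>0 powr z = 0\<close>, the term for \<open>n = 0\<close> is \<open>1\<close>.
\<close>
definition zeta_reg_term :: "nat \<Rightarrow> complex \<Rightarrow> complex" where
  "zeta_reg_term n s =
     (s - 1) * of_nat n powr (-s) + of_nat (Suc n) powr (1 - s) - of_nat n powr (1 - s)"

definition zeta_reg :: "complex \<Rightarrow> complex" where
  "zeta_reg s = (\<Sum>n. zeta_reg_term n s)"

lemma sum_zeta_reg_term:
  "(\<Sum>n<N. zeta_reg_term n s) = (s - 1) * (\<Sum>n<N. of_nat n powr (-s)) + of_nat N powr (1 - s)"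
  by (induction N) (simp_all add: zeta_reg_term_def algebra_simps)

lemma norm_zeta_reg_term_le:
  assumes "n > 0" "Re s \<ge> 0"
  shows   "norm (zeta_reg_term n s) \<le> norm (s - 1) * norm s * real n powr (-Re s - 1)"
proof -
  define f where "f = (\<lambda>x. (s - 1) * of_nat n powr (-s) * of_real x + of_real x powr (1 - s))"
  have "norm (f (real n + 1) - f (real n)) \<le>
      norm (s - 1) * norm s * real n powr (-Re s - 1) * ((real n + 1) - real n)"
  proof (rule norm_diff_le_vector_derivative)
    fix x assume x: "real n \<le> x" "x \<le> real n + 1"
    have "(f has_vector_derivative
        (s - 1) * of_nat n powr (-s) + (1 - s) * of_real x powr (1 - s - 1)) (at x)"
      unfolding f_def using x assms
      by (intro has_vector_derivative_add has_vector_derivative_of_real_powr)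
         (auto intro!: derivative_eq_intros)
    thus "(f has_vector_derivative (1 - s) * (of_real x powr (-s) - of_real (real n) powr (-s))) (at x)"
      by (simp add: algebra_simps)
    have "norm (of_real x powr (-s) - of_real (real n) powr (-s)) \<le>
        norm s * real n powr (-Re s - 1) * (x - real n)"
      using x assms by (intro norm_of_real_powr_diff_le) auto
    also have "\<dots> \<le> norm s * real n powr (-Re s - 1) * 1"
      using x by (intro mult_left_mono) auto
    finally have "norm (1 - s) * norm (of_real x powr (-s) - of_real (real n) powr (-s)) \<le>
        norm (1 - s) * (norm s * real n powr (-Re s - 1))"
      by (intro mult_left_mono) auto
    thus "norm ((1 - s) * (of_real x powr (-s) - of_real (real n) powr (-s))) \<le>
        norm (s - 1) * norm s * real n powr (-Re s - 1)"
      by (simp add: norm_mult norm_minus_commute mult.assoc)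
  qed auto
  moreover have "f (real n + 1) - f (real n) = zeta_reg_term n s"
    by (simp add: f_def zeta_reg_term_def algebra_simps)
  ultimately show ?thesis by simp
qed

lemma holomorphic_zeta_reg_term: "zeta_reg_term n holomorphic_on A"
  unfolding zeta_reg_term_def [abs_def]
  by (cases "n = 0") (auto intro!: holomorphic_intros simp del: of_nat_Suc)

lemma
  assumes s: "Re s > 0"
  shows sums_zeta_reg: "(\<lambda>n. zeta_reg_term n s) sums zeta_reg s"
    and field_differentiable_zeta_reg: "zeta_reg field_differentiable (at s)"
proof -
  define \<sigma> r where "\<sigma> = Re s / 2" and "r = norm s + 1"
  define S where "S = {z. Re z > \<sigma>} \<inter> ball 0 r"
  have "\<sigma> > 0" and "s \<in> S" using s by (auto simp: \<sigma>_def r_def S_def)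
  have "open S" by (simp add: S_def open_Int open_halfspace_Re_gt)
  have deriv: "(zeta_reg_term n has_field_derivative deriv (zeta_reg_term n) z) (at z)" for n z
    by (rule holomorphic_derivI[OF holomorphic_zeta_reg_term[of n UNIV]]) auto
  have bound: "norm (zeta_reg_term n z) \<le> (r + 1) * r * real n powr (-\<sigma> - 1)" if "n > 0" "z \<in> S" for n z
  proof -
    have "norm (zeta_reg_term n z) \<le> norm (z - 1) * norm z * real n powr (-Re z - 1)"
      using that \<open>\<sigma> > 0\<close> by (intro norm_zeta_reg_term_le) (auto simp: S_def)
    also have "\<dots> \<le> (r + 1) * r * real n powr (-\<sigma> - 1)"
      using that norm_triangle_ineq4[of z 1] by (intro mult_mono powr_mono) (auto simp: S_def r_def)
    finally show ?thesis .
  qed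
  have summable: "summable (\<lambda>n. (r + 1) * r * real n powr (-\<sigma> - 1))"
    using \<open>\<sigma> > 0\<close> by (intro summable_mult) (simp add: summable_real_powr_iff)
  obtain g g' where g: "\<forall>z\<in>S. (\<lambda>n. zeta_reg_term n z) sums g z \<and>
      (\<lambda>n. deriv (zeta_reg_term n) z) sums g' z \<and> (g has_field_derivative g' z) (at z)"
    by (rule series_and_derivative_comparison[OF \<open>open S\<close> summable deriv])
       (auto intro: bound eventually_mono[OF eventually_gt_at_top[of 0]])
  have g_eq: "g z = zeta_reg z" if "z \<in> S" for z
    using g that by (auto simp: zeta_reg_def sums_iff)
  show "(\<lambda>n. zeta_reg_term n s) sums zeta_reg s" using g g_eq \<open>s \<in> S\<close> by force
  have "(zeta_reg has_field_derivative g' s) (at s)"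
    using bspec[OF g \<open>s \<in> S\<close>]
    by (intro has_field_derivative_transform_within_open[OF _ \<open>open S\<close> \<open>s \<in> S\<close> g_eq]) auto
  thus "zeta_reg field_differentiable (at s)" by (auto simp: field_differentiable_def)
qed

lemma holomorphic_zeta_reg: "(\<And>s. s \<in> A \<Longrightarrow> Re s > 0) \<Longrightarrow> zeta_reg holomorphic_on A"
  by (auto simp: holomorphic_on_def intro!: field_differentiable_at_within field_differentiable_zeta_reg)

lemma has_field_derivative_zeta_reg:
  "Re s > 0 \<Longrightarrow> (zeta_reg has_field_derivative deriv zeta_reg s) (at s)"
  by (simp add: field_differentiable_derivI field_differentiable_zeta_reg)

lemma isCont_zeta_reg: "Re s > 0 \<Longrightarrow> isCont zeta_reg s"
  using has_field_derivative_zeta_reg by (rule DERIV_isCont)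

lemma zeta_reg_1 [simp]: "zeta_reg 1 = 1"
proof -
  have "zeta_reg_term n 1 = (if n = 0 then 1 else 0)" for n
    by (cases "n = 0") (simp_all add: zeta_reg_term_def del: of_nat_Suc)
  thus ?thesis using sums_single[of 0 "\<lambda>_. 1 :: complex"] by (simp add: zeta_reg_def sums_iff)
qed

lemma zeta_reg_eq_zeta:
  assumes "Re s > 1"
  shows   "zeta_reg s = (s - 1) * zeta s"
proof -
  have "(\<lambda>N. norm (of_nat N powr (1 - s) :: complex)) \<longlonglongrightarrow> 0"
    unfolding norm_of_nat_powr
    using tendsto_neg_powr[of "1 - Re s", OF _ filterlim_real_sequentially] assms by simp
  hence "(\<lambda>N. of_nat N powr (1 - s) :: complex) \<longlonglongrightarrow> 0"
    by (simp only: tendsto_norm_zero_iff)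
  hence "(\<lambda>N. \<Sum>n<N. zeta_reg_term n s) \<longlonglongrightarrow> (s - 1) * zeta s + 0"
    unfolding sum_zeta_reg_term
    using sums_zeta[OF assms] by (intro tendsto_intros) (simp add: sums_def)
  moreover have "(\<lambda>N. \<Sum>n<N. zeta_reg_term n s) \<longlonglongrightarrow> zeta_reg s"
    using sums_zeta_reg[of s] assms by (simp add: sums_def)
  ultimately show ?thesis using LIMSEQ_unique by fastforce
qed

lemma zeta_reg_nonzero_Re_gt_1: "Re s > 1 \<Longrightarrow> zeta_reg s \<noteq> 0"
  by (auto simp: zeta_reg_eq_zeta zeta_eq_exp_log_zeta)

lemma norm_zeta_reg_le_truncated:
  assumes "N > 0" "Re s > 0"
  shows   "norm (zeta_reg s) \<le> norm (s - 1) * (\<Sum>n\<le>N. real n powr (-Re s)) + real N powr (1 - Re s) +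
             norm (s - 1) * norm s * (real N powr (-Re s - 1) + real N powr (-Re s) / Re s)"
    (is "_ \<le> ?B")
proof (rule LIMSEQ_le_const2[OF tendsto_norm])
  show "(\<lambda>M. \<Sum>n<M. zeta_reg_term n s) \<longlonglongrightarrow> zeta_reg s"
    using sums_zeta_reg[OF assms(2)] by (simp add: sums_def)
  show "\<exists>M0. \<forall>M\<ge>M0. norm (\<Sum>n<M. zeta_reg_term n s) \<le> ?B"
  proof (intro exI allI impI)
    fix M assume "N \<le> M"
    have "norm (\<Sum>n<N. of_nat n powr (-s) :: complex) \<le> (\<Sum>n<N. real n powr (-Re s))"
      by (rule order.trans[OF norm_sum]) (simp add: norm_of_nat_powr)
    also have "\<dots> \<le> (\<Sum>n\<le>N. real n powr (-Re s))" by (intro sum_mono2) auto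
    finally have "norm (\<Sum>n<N. zeta_reg_term n s) \<le>
        norm (s - 1) * (\<Sum>n\<le>N. real n powr (-Re s)) + real N powr (1 - Re s)"
      unfolding sum_zeta_reg_term
      by (intro order.trans[OF norm_triangle_ineq] add_mono)
         (auto simp: norm_mult norm_of_nat_powr mult_left_mono)
    moreover have "norm (\<Sum>n=N..<M. zeta_reg_term n s) \<le>
        norm (s - 1) * norm s * (real N powr (-Re s - 1) + real N powr (-Re s) / Re s)"
    proof -
      have "norm (\<Sum>n=N..<M. zeta_reg_term n s) \<le>
          (\<Sum>n=N..<M. norm (s - 1) * norm s * real n powr (-Re s - 1))"
        using assms by (intro sum_norm_le norm_zeta_reg_term_le) auto
      also have "\<dots> = norm (s - 1) * norm s * (\<Sum>n=N..<M. real n powr (-Re s - 1))"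
        by (simp add: sum_distrib_left)
      finally show ?thesis
        using sum_powr_tail_le[OF assms(2,1), of M]
        by (meson mult_left_mono norm_ge_zero order.trans mult_nonneg_nonneg)
    qed
    moreover have "(\<Sum>n<M. zeta_reg_term n s) =
        (\<Sum>n<N. zeta_reg_term n s) + (\<Sum>n=N..<M. zeta_reg_term n s)"
      using \<open>N \<le> M\<close> by (simp add: sum.atLeastLessThan_concat lessThan_atLeast0)
    ultimately show "norm (\<Sum>n<M. zeta_reg_term n s) \<le> ?B"
      using norm_triangle_ineq[of "\<Sum>n<N. zeta_reg_term n s" "\<Sum>n=N..<M. zeta_reg_term n s"] by simp
  qed
qed

lemma norm_zeta_reg_le:
  assumes \<delta>: "0 < \<delta>" "\<delta> \<le> 1/2" and s: "1 - \<delta> \<le> Re s" "Re s \<le> 3" "\<bar>Im s\<bar> \<ge> 1"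
  shows   "norm (zeta_reg s) \<le> 31 / \<delta> * \<bar>Im s\<bar> powr (1 + \<delta>)"
proof -
  define t N where "t = \<bar>Im s\<bar>" and "N = nat \<lceil>t\<rceil>"
  have t: "t \<ge> 1" using s by (simp add: t_def)
  have N: "N > 0" "real N \<ge> t" "real N \<le> 2 * t" using t unfolding N_def by linarith+
  have norm_s: "norm s \<le> 4 * t" "norm (s - 1) \<le> 3 * t"
    using cmod_le[of s] cmod_le[of "s - 1"] s \<delta> t by (simp_all add: t_def)
  have "real N powr \<delta> \<le> (2 * t) powr \<delta>" using N \<delta> by (intro powr_mono2) auto
  also have "\<dots> \<le> 2 ^ 1 * t powr \<delta>" using t \<delta> by (intro powr_double_le) auto
  finally have powr_N: "real N powr \<delta> \<le> 2 * t powr \<delta>" by simp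
  have "(\<Sum>n\<le>N. real n powr (-Re s)) \<le> 2 / \<delta> * real N powr \<delta>"
    using N s \<delta> by (intro sum_powr_neg_le) auto
  also have "\<dots> \<le> 4 / \<delta> * t powr \<delta>" using powr_N \<delta> by (simp add: field_simps)
  finally have head: "norm (s - 1) * (\<Sum>n\<le>N. real n powr (-Re s)) \<le> (3 * t) * (4 / \<delta> * t powr \<delta>)"
    using norm_s t by (intro mult_mono) (auto intro!: sum_nonneg)
  have "real N powr (1 - Re s) \<le> real N powr \<delta>" using N s by (intro powr_mono) auto
  also have "\<dots> \<le> 1 * (2 * t powr \<delta>)" using powr_N by simp
  also have "\<dots> \<le> t * (2 * t powr \<delta>)" using t by (intro mult_right_mono) auto
  finally have middle: "real N powr (1 - Re s) \<le> t * (2 * t powr \<delta>)" .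
  have "real N powr (-Re s - 1) + real N powr (-Re s) / Re s \<le>
      real N powr (-Re s) + real N powr (-Re s) * 2"
    using N s \<delta> by (intro add_mono powr_mono) (auto simp: divide_simps)
  also have "\<dots> = 3 * real N powr (-Re s)" by simp
  also have "real N powr (-Re s) \<le> real N powr (\<delta> - 1)" using N s by (intro powr_mono) auto
  also have "\<dots> \<le> t powr (\<delta> - 1)" using N t \<delta> by (intro powr_mono2') auto
  finally have "norm (s - 1) * norm s * (real N powr (-Re s - 1) + real N powr (-Re s) / Re s) \<le>
      (3 * t) * (4 * t) * (3 * t powr (\<delta> - 1))"
    using norm_s t s \<delta> by (intro mult_mono) auto
  also have "\<dots> = 36 * (t * t powr \<delta>)" using t by (simp add: powr_diff)
  finally have tail:
    "norm (s - 1) * norm s * (real N powr (-Re s - 1) + real N powr (-Re s) / Re s) \<le> \<dots>" .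
  have "norm (zeta_reg s) \<le> (3 * t) * (4 / \<delta> * t powr \<delta>) + t * (2 * t powr \<delta>) + 36 * (t * t powr \<delta>)"
    using norm_zeta_reg_le_truncated[OF N(1), of s] head middle tail s \<delta> by linarith
  also have "\<dots> = (12 / \<delta> + 38) * (t * t powr \<delta>)" by (simp add: algebra_simps)
  also have "\<dots> \<le> 31 / \<delta> * (t * t powr \<delta>)"
    using \<delta> t by (intro mult_right_mono) (auto simp: field_simps)
  also have "t * t powr \<delta> = t powr (1 + \<delta>)" using t by (simp add: powr_add)
  finally show ?thesis by (simp add: t_def)
qed

lemma norm_zeta_reg_quotient_le:
  assumes \<delta>: "0 < \<delta>" "\<delta> \<le> 1/2" and s: "1 - \<delta> \<le> Re s" "Re s \<le> 3" "\<bar>Im s\<bar> \<ge> 1"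
  shows   "norm ((zeta_reg s - 1) / (s - 1)) \<le> 32 / \<delta> * \<bar>Im s\<bar> powr \<delta>"
proof -
  define t where "t = \<bar>Im s\<bar>"
  have t: "t \<ge> 1" using s by (simp add: t_def)
  have "norm (zeta_reg s) \<le> 31 / \<delta> * t powr (1 + \<delta>)"
    unfolding t_def by (rule norm_zeta_reg_le[OF \<delta> s])
  moreover have "1 * 1 \<le> 1 / \<delta> * t powr (1 + \<delta>)"
    using \<delta> t by (intro mult_mono ge_one_powr_ge_zero) auto
  moreover have "32 / \<delta> * t powr (1 + \<delta>) = 31 / \<delta> * t powr (1 + \<delta>) + 1 / \<delta> * t powr (1 + \<delta>)"
    by (simp add: field_simps)
  ultimately have "norm (zeta_reg s - 1) \<le> 32 / \<delta> * t powr (1 + \<delta>)"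
    using norm_triangle_ineq4[of "zeta_reg s" 1] unfolding norm_one by linarith
  hence "norm ((zeta_reg s - 1) / (s - 1)) \<le> (32 / \<delta> * t powr (1 + \<delta>)) / t"
    unfolding norm_divide using t \<delta> abs_Im_le_cmod[of "s - 1"] by (intro frac_le) (auto simp: t_def)
  also have "\<dots> = 32 / \<delta> * t powr \<delta>" using t by (simp add: powr_add)
  finally show ?thesis by (simp add: t_def)
qed

lemma norm_deriv_zeta_reg_le:
  assumes \<delta>: "0 < \<delta>" "\<delta> \<le> 1/2" and s: "1 - \<delta> / 2 \<le> Re s" "Re s \<le> 2" "\<bar>Im s\<bar> \<ge> 2"
  shows   "norm (deriv zeta_reg s) \<le> 248 / \<delta>\<^sup>2 * \<bar>Im s\<bar> powr (1 + \<delta>)"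
proof -
  define B where "B = 31 / \<delta> * (4 * \<bar>Im s\<bar> powr (1 + \<delta>))"
  have near: "\<bar>Re z - Re s\<bar> \<le> \<delta> / 2 \<and> \<bar>Im z - Im s\<bar> \<le> \<delta> / 2" if "norm (s - z) \<le> \<delta> / 2" for z
    using abs_Re_le_cmod[of "s - z"] abs_Im_le_cmod[of "s - z"] that
    unfolding minus_complex.sel by linarith
  have "Re z > 0" if "norm (s - z) \<le> \<delta> / 2" for z using near[OF that] s \<delta> by linarith
  hence hol: "zeta_reg holomorphic_on cball s (\<delta> / 2)"
    by (intro holomorphic_zeta_reg) (auto simp: dist_norm)
  have "norm ((deriv ^^ 1) zeta_reg s) \<le> fact 1 * B / (\<delta> / 2) ^ 1"
  proof (rule Cauchy_inequality)
    fix z assume "norm (s - z) = \<delta> / 2"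
    hence z: "\<bar>Re z - Re s\<bar> \<le> \<delta> / 2" "\<bar>Im z - Im s\<bar> \<le> \<delta> / 2" using near[of z] by auto
    have "\<bar>Im z\<bar> \<le> 2 * \<bar>Im s\<bar>" using z s \<delta> by linarith
    hence "\<bar>Im z\<bar> powr (1 + \<delta>) \<le> (2 * \<bar>Im s\<bar>) powr (1 + \<delta>)" using \<delta> by (intro powr_mono2) auto
    also have "\<dots> \<le> 2 ^ 2 * \<bar>Im s\<bar> powr (1 + \<delta>)" using \<delta> by (intro powr_double_le) auto
    finally have "31 / \<delta> * \<bar>Im z\<bar> powr (1 + \<delta>) \<le> B"
      unfolding B_def using \<delta> by (intro mult_left_mono) auto
    moreover have "norm (zeta_reg z) \<le> 31 / \<delta> * \<bar>Im z\<bar> powr (1 + \<delta>)"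
      using z s \<delta> by (intro norm_zeta_reg_le) (auto simp: abs_if split: if_splits)
    ultimately show "norm (zeta_reg z) \<le> B" by linarith
  qed (use \<delta> in \<open>auto intro: holomorphic_on_subset[OF hol] holomorphic_on_imp_continuous_on[OF hol]\<close>)
  also have "\<dots> = 248 / \<delta>\<^sup>2 * \<bar>Im s\<bar> powr (1 + \<delta>)" by (simp add: B_def power2_eq_square)
  finally show ?thesis by simp
qed

lemma norm_zeta_reg_341_ge:
  assumes "\<sigma> > 1"
  shows   "(\<sigma> - 1) ^ 3 * \<bar>t\<bar> ^ 5 \<le>
             norm (zeta_reg (of_real \<sigma>)) ^ 3 * norm (zeta_reg (Complex \<sigma> t)) ^ 4 *
             norm (zeta_reg (Complex \<sigma> (2 * t)))"
proof -
  define z where "z = (\<lambda>u. norm (zeta (Complex \<sigma> u)))"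
  have norm_zeta_reg: "norm (zeta_reg (Complex \<sigma> u)) = norm (Complex \<sigma> u - 1) * z u" for u
    using assms by (simp add: z_def zeta_reg_eq_zeta norm_mult)
  have norm_ge: "norm (Complex \<sigma> u - 1) \<ge> \<bar>u\<bar>" for u
    using abs_Im_le_cmod[of "Complex \<sigma> u - 1"] by simp
  have "z 0 ^ 3 * z t ^ 4 * z (2 * t) \<ge> 1"
    using norm_zeta_341_ge[OF assms, of t] by (simp add: z_def complex_of_real_def)
  moreover have "\<bar>t\<bar> ^ 4 * \<bar>t\<bar> \<le> norm (Complex \<sigma> t - 1) ^ 4 * norm (Complex \<sigma> (2 * t) - 1)"
    using norm_ge[of t] norm_ge[of "2 * t"] by (intro mult_mono power_mono) auto
  ultimately have "(\<sigma> - 1) ^ 3 * (\<bar>t\<bar> ^ 4 * \<bar>t\<bar>) * 1 \<le>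
      (\<sigma> - 1) ^ 3 * (norm (Complex \<sigma> t - 1) ^ 4 * norm (Complex \<sigma> (2 * t) - 1)) *
      (z 0 ^ 3 * z t ^ 4 * z (2 * t))"
    using assms by (intro mult_mono[OF mult_left_mono]) auto
  moreover have "norm (zeta_reg (of_real \<sigma>)) = (\<sigma> - 1) * z 0"
    using assms norm_zeta_reg[of 0] cmod_eq_Re[of "Complex \<sigma> 0 - 1"]
    by (simp add: complex_of_real_def)
  ultimately show ?thesis
    unfolding norm_zeta_reg by (simp add: power_mult_distrib eval_nat_numeral mult_ac)
qed

lemma isCont_imp_bigo_at_right:
  fixes f :: "complex \<Rightarrow> complex"
  assumes "isCont f s"
  shows   "(\<lambda>h. f (s + of_real h)) \<in> O[at_right 0](\<lambda>_. 1)"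
proof (rule bigoI_tendsto)
  have "((\<lambda>h. f (s + of_real h)) \<longlongrightarrow> f s) (at_right 0)"
    by (rule isCont_tendsto_compose[OF assms]) (auto intro!: tendsto_eq_intros)
  thus "((\<lambda>h. f (s + of_real h) / 1) \<longlongrightarrow> f s) (at_right 0)" by simp
qed auto

lemma zero_imp_bigo_at_right:
  fixes f :: "complex \<Rightarrow> complex"
  assumes "(f has_field_derivative f') (at s)" "f s = 0"
  shows   "(\<lambda>h. f (s + of_real h)) \<in> O[at_right 0](\<lambda>h. of_real h)"
proof (rule bigoI_tendsto)
  have "(\<lambda>h. f (s + h) / h) \<midarrow>0\<rightarrow> f'" using assms by (simp add: DERIV_def)
  moreover have "filterlim (\<lambda>h. complex_of_real h) (at 0) (at_right 0)"
    unfolding filterlim_at by (auto intro!: tendsto_eq_intros simp: eventually_at_filter)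
  ultimately show "((\<lambda>h. f (s + of_real h) / of_real h) \<longlongrightarrow> f') (at_right 0)"
    by (rule filterlim_compose)
qed (auto simp: eventually_at_filter)

text \<open>At a zero on the line the right-hand side of \<open>norm_zeta_reg_341_ge\<close> would be \<open>O((\<sigma> - 1)\<^sup>4)\<close>.\<close>
lemma zeta_reg_nonzero_Re_eq_1:
  assumes "Re s = 1"
  shows   "zeta_reg s \<noteq> 0"
proof
  assume zero: "zeta_reg s = 0"
  define t where "t = Im s"
  define f where "f = (\<lambda>u h. zeta_reg (Complex 1 u + of_real h))"
  have s: "s = Complex 1 t" using assms by (simp add: complex_eq_iff t_def)
  have "s \<noteq> 1" using zero by auto
  hence "t \<noteq> 0" using s by (auto simp: complex_eq_iff)
  have cont: "f u \<in> O[at_right 0](\<lambda>_. 1)" for u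
    unfolding f_def by (intro isCont_imp_bigo_at_right isCont_zeta_reg) simp
  have linear: "f t \<in> O[at_right 0](\<lambda>h. of_real h)"
    unfolding f_def
    using zero s by (intro zero_imp_bigo_at_right[OF has_field_derivative_zeta_reg]) auto
  have "(\<lambda>h. f 0 h ^ 3 * f t h ^ 4 * f (2 * t) h) \<in> O[at_right 0](\<lambda>h. 1 ^ 3 * of_real h ^ 4 * 1)"
    by (intro landau_o.big.mult landau_o.big_power cont linear)
  hence "(\<lambda>h. norm (f 0 h ^ 3 * f t h ^ 4 * f (2 * t) h))
      \<in> O[at_right 0](\<lambda>h. norm (1 ^ 3 * of_real h ^ 4 * 1 :: complex))"
    by (subst landau_o.big.norm_iff)
  hence upper: "(\<lambda>h. norm (f 0 h ^ 3 * f t h ^ 4 * f (2 * t) h)) \<in> O[at_right 0](\<lambda>h. h ^ 4)"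
    by (simp add: norm_power)
  have "(\<lambda>h. h ^ 3 * \<bar>t\<bar> ^ 5) \<in> O[at_right 0](\<lambda>h. norm (f 0 h ^ 3 * f t h ^ 4 * f (2 * t) h))"
  proof (rule bigoI[of _ 1], rule eventually_mono[OF eventually_at_right_less])
    fix h :: real assume "0 < h"
    moreover have "f u h = zeta_reg (Complex (1 + h) u)" for u
      unfolding f_def by (rule arg_cong[of _ _ zeta_reg]) (simp add: complex_eq_iff)
    ultimately show "norm (h ^ 3 * \<bar>t\<bar> ^ 5) \<le> 1 * norm (norm (f 0 h ^ 3 * f t h ^ 4 * f (2 * t) h))"
      using norm_zeta_reg_341_ge[of "1 + h" t]
      by (simp add: norm_mult norm_power abs_mult complex_of_real_def)
  qed
  from landau_o.big_trans[OF this upper] have "(\<lambda>h. h ^ 3) \<in> O[at_right 0](\<lambda>h::real. h ^ 4)"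
    using \<open>t \<noteq> 0\<close> by simp
  moreover have "(\<lambda>h::real. h ^ 4) \<in> o[at_right 0](\<lambda>h. h ^ 3)" by real_asymp
  ultimately have "\<forall>\<^sub>F h::real in at_right 0. h ^ 4 = 0"
    by (rule landau_o.small_big_asymmetric[rotated])
  hence "\<forall>\<^sub>F h::real in at_right 0. False"
    using eventually_at_right_less by eventually_elim auto
  thus False by simp
qed

section \<open>A zero-free region\<close>

lemma norm_zeta_reg_ge_right:
  assumes \<delta>: "0 < \<delta>" "\<delta> \<le> 1/2"
  obtains c where "c > 0" "\<And>\<eta> t. 0 < \<eta> \<Longrightarrow> \<eta> \<le> 1 \<Longrightarrow> \<bar>t\<bar> \<ge> 1 \<Longrightarrow>
    norm (zeta_reg (Complex (1 + \<eta>) t)) \<ge> c * \<eta> powr (3/4) * \<bar>t\<bar> powr (1 - \<delta> / 4)"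
proof -
  have "bounded (zeta_reg ` of_real ` {1..2})"
    by (intro compact_imp_bounded compact_continuous_image holomorphic_on_imp_continuous_on
          holomorphic_zeta_reg continuous_intros) auto
  then obtain C where C: "C > 0" "\<And>\<sigma>. 1 \<le> \<sigma> \<Longrightarrow> \<sigma> \<le> 2 \<Longrightarrow> norm (zeta_reg (of_real \<sigma>)) \<le> C"
    unfolding bounded_pos by auto
  define P where "P = C ^ 3 * (31 / \<delta> * 4)"
  have P: "P > 0" using C \<delta> by (simp add: P_def)
  show thesis
  proof (rule that[of "1 / root 4 P"])
    fix \<eta> t :: real assume \<eta>: "0 < \<eta>" "\<eta> \<le> 1" and t: "\<bar>t\<bar> \<ge> 1"
    define z where "z = norm (zeta_reg (Complex (1 + \<eta>) t))"
    have "norm (zeta_reg (Complex (1 + \<eta>) (2 * t))) \<le> 31 / \<delta> * (2 * \<bar>t\<bar>) powr (1 + \<delta>)"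
      using norm_zeta_reg_le[OF \<delta>, of "Complex (1 + \<eta>) (2 * t)"] \<eta> t \<delta> by (simp add: abs_mult)
    also have "\<dots> \<le> 31 / \<delta> * (2 ^ 2 * \<bar>t\<bar> powr (1 + \<delta>))"
      using \<delta> by (intro mult_left_mono powr_double_le) auto
    finally have "norm (zeta_reg (of_real (1 + \<eta>))) ^ 3 * z ^ 4 *
          norm (zeta_reg (Complex (1 + \<eta>) (2 * t))) \<le>
        C ^ 3 * z ^ 4 * (31 / \<delta> * (4 * \<bar>t\<bar> powr (1 + \<delta>)))"
      using C(1) \<eta> by (intro mult_mono power_mono C(2)) (auto simp: z_def)
    also have "\<dots> = P * z ^ 4 * \<bar>t\<bar> powr (1 + \<delta>)" by (simp add: P_def)
    finally have "\<eta> ^ 3 * \<bar>t\<bar> ^ 5 \<le> P * z ^ 4 * \<bar>t\<bar> powr (1 + \<delta>)"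
      using norm_zeta_reg_341_ge[of "1 + \<eta>" t] \<eta> by (simp add: z_def)
    moreover have "\<bar>t\<bar> ^ 5 = \<bar>t\<bar> powr (4 - \<delta>) * \<bar>t\<bar> powr (1 + \<delta>)"
      using t by (simp flip: powr_add)
    ultimately have "(\<eta> ^ 3 * \<bar>t\<bar> powr (4 - \<delta>)) * \<bar>t\<bar> powr (1 + \<delta>) \<le> (P * z ^ 4) * \<bar>t\<bar> powr (1 + \<delta>)"
      by (simp only: mult.assoc)
    hence "\<eta> ^ 3 * \<bar>t\<bar> powr (4 - \<delta>) \<le> P * z ^ 4"
      by (rule mult_right_le_imp_le) (use t in auto)
    also have "\<eta> ^ 3 * \<bar>t\<bar> powr (4 - \<delta>) = (\<eta> powr (3/4) * \<bar>t\<bar> powr (1 - \<delta> / 4)) ^ 4"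
      using \<eta> t by (simp add: power_mult_distrib powr_power algebra_simps)
    also have "P * z ^ 4 = (root 4 P * z) ^ 4" using P by (simp add: power_mult_distrib)
    finally have "\<eta> powr (3/4) * \<bar>t\<bar> powr (1 - \<delta> / 4) \<le> root 4 P * z"
      by (rule power_le_imp_le_base[of _ 3, simplified]) (use P in \<open>simp add: z_def\<close>)
    thus "norm (zeta_reg (Complex (1 + \<eta>) t)) \<ge> 1 / root 4 P * \<eta> powr (3/4) * \<bar>t\<bar> powr (1 - \<delta> / 4)"
      using P by (simp add: z_def field_simps)
  qed (use P in simp)
qed

lemma norm_zeta_reg_diff_le:
  assumes \<delta>: "0 < \<delta>" "\<delta> \<le> 1/2" and "\<eta> \<le> \<delta> / 2" "\<bar>Re s - 1\<bar> \<le> \<eta>" "\<bar>Im s\<bar> \<ge> 2"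
  shows   "norm (zeta_reg (Complex (1 + \<eta>) (Im s)) - zeta_reg s) \<le>
             248 / \<delta>\<^sup>2 * \<bar>Im s\<bar> powr (1 + \<delta>) * (2 * \<eta>)"
proof -
  define S where "S = closed_segment s (Complex (1 + \<eta>) (Im s))"
  have "S = {z. Im z = Im s \<and> Re z \<in> closed_segment (Re s) (1 + \<eta>)}"
    unfolding S_def by (subst closed_segment_same_Im) simp_all
  hence S: "Im z = Im s \<and> \<bar>Re z - 1\<bar> \<le> \<eta>" if "z \<in> S" for z
    using that assms(4) by (auto simp: closed_segment_eq_real_ivl split: if_splits)
  have "norm (zeta_reg (Complex (1 + \<eta>) (Im s)) - zeta_reg s) \<le>
      248 / \<delta>\<^sup>2 * \<bar>Im s\<bar> powr (1 + \<delta>) * norm (Complex (1 + \<eta>) (Im s) - s)"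
  proof (rule field_differentiable_bound[of S])
    fix z assume "z \<in> S"
    from S[OF this] have z: "Im z = Im s" "1 - \<delta> / 2 \<le> Re z" "Re z \<le> 2" "Re z > 0"
      using assms by linarith+
    show "(zeta_reg has_field_derivative deriv zeta_reg z) (at z within S)"
      by (rule has_field_derivative_at_within[OF has_field_derivative_zeta_reg[OF z(4)]])
    show "norm (deriv zeta_reg z) \<le> 248 / \<delta>\<^sup>2 * \<bar>Im s\<bar> powr (1 + \<delta>)"
      using norm_deriv_zeta_reg_le[OF \<delta>, of z] z assms(5) by simp
  qed (auto simp: S_def)
  also have "\<dots> \<le> 248 / \<delta>\<^sup>2 * \<bar>Im s\<bar> powr (1 + \<delta>) * (2 * \<eta>)"
  proof (rule mult_left_mono)
    have "Complex (1 + \<eta>) (Im s) - s = of_real (1 + \<eta> - Re s)" by (simp add: complex_eq_iff)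
    hence "norm (Complex (1 + \<eta>) (Im s) - s) = \<bar>1 + \<eta> - Re s\<bar>" by (simp only: norm_of_real)
    thus "norm (Complex (1 + \<eta>) (Im s) - s) \<le> 2 * \<eta>" using assms(4) by linarith
  qed simp
  finally show ?thesis .
qed

lemma near_line_exponents:
  fixes l t \<delta> :: real
  assumes "l > 0" "t > 0"
  defines "\<eta> \<equiv> l ^ 4 * t powr (-5 * \<delta>)"
  shows   "\<eta> powr (3/4) * t powr (1 - \<delta> / 4) = l ^ 3 * t powr (1 - 4 * \<delta>)"
    and   "t powr (1 + \<delta>) * \<eta> = l ^ 4 * t powr (1 - 4 * \<delta>)"
proof -
  have "\<eta> powr (3/4) = l ^ 3 * t powr (-15 / 4 * \<delta>)"
    using assms by (simp add: \<eta>_def powr_mult powr_powr flip: powr_numeral)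
  thus "\<eta> powr (3/4) * t powr (1 - \<delta> / 4) = l ^ 3 * t powr (1 - 4 * \<delta>)"
    by (simp flip: powr_add)
  show "t powr (1 + \<delta>) * \<eta> = l ^ 4 * t powr (1 - 4 * \<delta>)"
    by (simp add: \<eta>_def flip: powr_add)
qed

text \<open>
  The lower bound at distance \<open>\<eta>\<close> to the right of the line survives a horizontal shift by \<open>2\<eta>\<close>
  as soon as \<open>\<eta> powr (1/4)\<close> is a small multiple of \<open>\<bar>t\<bar> powr (- 5 * \<delta> / 4)\<close>.
\<close>
lemma norm_zeta_reg_ge_near_line:
  assumes \<delta>: "0 < \<delta>" "\<delta> \<le> 1/2"
  obtains \<kappa> c where "\<kappa> > 0" "c > 0" "\<kappa> \<le> \<delta> / 2"
    "\<And>s. \<bar>Im s\<bar> \<ge> 2 \<Longrightarrow> \<bar>Re s - 1\<bar> \<le> \<kappa> * \<bar>Im s\<bar> powr (-5 * \<delta>) \<Longrightarrow>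
       norm (zeta_reg s) \<ge> c * \<bar>Im s\<bar> powr (1 - 4 * \<delta>)"
proof -
  obtain c where c: "c > 0" "\<And>\<eta> t. 0 < \<eta> \<Longrightarrow> \<eta> \<le> 1 \<Longrightarrow> \<bar>t\<bar> \<ge> 1 \<Longrightarrow>
    norm (zeta_reg (Complex (1 + \<eta>) t)) \<ge> c * \<eta> powr (3/4) * \<bar>t\<bar> powr (1 - \<delta> / 4)"
    using norm_zeta_reg_ge_right[OF \<delta>] by blast
  define C where "C = 248 / \<delta>\<^sup>2"
  have C: "C > 0" using \<delta> by (simp add: C_def)
  define l where "l = min (\<delta> / 2) (c / (4 * C))"
  have l: "l > 0" "l \<le> \<delta> / 2" "4 * C * l \<le> c" using c C \<delta> by (auto simp: l_def min_def field_simps)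
  have "l ^ 4 \<le> l" using power_decreasing[of 1 4 l] l \<delta> by simp
  hence l4: "l ^ 4 \<le> \<delta> / 2" using l by linarith
  show thesis
  proof (rule that[of "l ^ 4" "c * l ^ 3 / 2"])
    fix s assume s: "\<bar>Im s\<bar> \<ge> 2" "\<bar>Re s - 1\<bar> \<le> l ^ 4 * \<bar>Im s\<bar> powr (-5 * \<delta>)"
    define t where "t = \<bar>Im s\<bar>"
    define \<eta> where "\<eta> = l ^ 4 * t powr (-5 * \<delta>)"
    have t: "t \<ge> 2" using s by (simp add: t_def)
    have "\<eta> \<le> l ^ 4" using mult_powr_minus_le[of "l ^ 4" t "5 * \<delta>"] l t \<delta> by (simp add: \<eta>_def)
    hence \<eta>: "\<eta> \<le> \<delta> / 2" using l4 by linarith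
    have "\<eta> > 0" using l t by (simp add: \<eta>_def)
    have "c * l ^ 3 * t powr (1 - 4 * \<delta>) \<le> norm (zeta_reg (Complex (1 + \<eta>) (Im s)))"
      using c(2)[of \<eta> "Im s"] near_line_exponents(1)[of l t \<delta>] \<open>\<eta> > 0\<close> \<eta> \<delta> l t
      by (simp add: \<eta>_def t_def mult.assoc)
    moreover have "norm (zeta_reg (Complex (1 + \<eta>) (Im s)) - zeta_reg s) \<le>
        c * l ^ 3 * t powr (1 - 4 * \<delta>) / 2"
    proof -
      have "norm (zeta_reg (Complex (1 + \<eta>) (Im s)) - zeta_reg s) \<le> C * t powr (1 + \<delta>) * (2 * \<eta>)"
        unfolding C_def t_def using \<eta> s by (intro norm_zeta_reg_diff_le \<delta>) (auto simp: \<eta>_def t_def)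
      also have "\<dots> = 2 * C * (t powr (1 + \<delta>) * \<eta>)" by simp
      also have "\<dots> = (4 * C * l) * (l ^ 3 / 2 * t powr (1 - 4 * \<delta>))"
        using near_line_exponents(2)[of l t \<delta>] l t by (simp add: \<eta>_def eval_nat_numeral)
      also have "\<dots> \<le> c * (l ^ 3 / 2 * t powr (1 - 4 * \<delta>))" using l by (intro mult_right_mono) auto
      finally show ?thesis by simp
    qed
    moreover have "c * l ^ 3 / 2 * t powr (1 - 4 * \<delta>) = c * l ^ 3 * t powr (1 - 4 * \<delta>) / 2" by simp
    ultimately show "norm (zeta_reg s) \<ge> c * l ^ 3 / 2 * \<bar>Im s\<bar> powr (1 - 4 * \<delta>)"
      using norm_triangle_ineq2[of "zeta_reg (Complex (1 + \<eta>) (Im s))" "zeta_reg s"]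
      unfolding t_def by linarith
  qed (use l l4 c in auto)
qed

text \<open>The analytic continuation of \<open>- \<zeta>'(s) / \<zeta>(s) - \<zeta>(s)\<close>, in which the two poles at \<open>s = 1\<close> cancel.\<close>
definition mangoldt_diff :: "complex \<Rightarrow> complex" where
  "mangoldt_diff s = - (deriv zeta_reg s / zeta_reg s) -
     (if s = 1 then deriv zeta_reg 1 else (zeta_reg s - zeta_reg 1) / (s - 1))"

lemma holomorphic_mangoldt_diff:
  assumes "open A" "\<And>s. s \<in> A \<Longrightarrow> Re s > 0 \<and> zeta_reg s \<noteq> 0"
  shows   "mangoldt_diff holomorphic_on A"
proof -
  have "zeta_reg holomorphic_on A" using assms(2) by (intro holomorphic_zeta_reg) auto
  thus ?thesis
    unfolding mangoldt_diff_def using assms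
    by (intro holomorphic_intros pole_lemma_open holomorphic_deriv) auto
qed

lemma sums_mangoldt_diff:
  assumes s: "Re s > 1"
  shows   "(\<lambda>n. (mangoldt n - 1) * of_nat n powr (-s)) sums mangoldt_diff s"
proof -
  define D where "D = dirichlet mangoldt s"
  have "((\<lambda>s. (s - 1) * zeta s) has_field_derivative zeta s - (s - 1) * (D * zeta s)) (at s)"
    unfolding D_def using s by (auto intro!: derivative_eq_intros has_field_derivative_zeta[OF s])
  hence "(zeta_reg has_field_derivative zeta s - (s - 1) * (D * zeta s)) (at s)"
    by (rule has_field_derivative_transform_within_open[OF _ open_halfspace_Re_gt[of 1]])
       (use s in \<open>auto simp: zeta_reg_eq_zeta\<close>)
  hence "deriv zeta_reg s = zeta s - (s - 1) * (D * zeta s)" by (rule DERIV_imp_deriv)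
  moreover have "s \<noteq> 1" "zeta s \<noteq> 0" using s by (auto simp: zeta_eq_exp_log_zeta)
  ultimately have "mangoldt_diff s = D - zeta s"
    using s by (simp add: mangoldt_diff_def zeta_reg_eq_zeta divide_simps) (simp add: algebra_simps)
  moreover have "(\<lambda>n. mangoldt n * of_nat n powr (-s) - of_nat n powr (-s)) sums (D - zeta s)"
    unfolding D_def
    by (intro sums_diff sums_dirichlet[OF abs_conv_abscissa_le_mangoldt] sums_zeta s)
  ultimately show ?thesis by (simp add: left_diff_distrib)
qed

lemma norm_mangoldt_diff_le_large:
  assumes \<delta>: "0 < \<delta>" "\<delta> \<le> 1/2"
  obtains \<kappa> M where "\<kappa> > 0" "\<kappa> \<le> \<delta> / 2" "M > 0"
    "\<And>s. \<bar>Im s\<bar> \<ge> 2 \<Longrightarrow> \<bar>Re s - 1\<bar> \<le> \<kappa> * \<bar>Im s\<bar> powr (-5 * \<delta>) \<Longrightarrow>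
       zeta_reg s \<noteq> 0 \<and> norm (mangoldt_diff s) \<le> M * \<bar>Im s\<bar> powr (5 * \<delta>)"
proof -
  obtain \<kappa> c where \<kappa>c: "\<kappa> > 0" "c > 0" "\<kappa> \<le> \<delta> / 2"
    "\<And>s. \<bar>Im s\<bar> \<ge> 2 \<Longrightarrow> \<bar>Re s - 1\<bar> \<le> \<kappa> * \<bar>Im s\<bar> powr (-5 * \<delta>) \<Longrightarrow>
       norm (zeta_reg s) \<ge> c * \<bar>Im s\<bar> powr (1 - 4 * \<delta>)"
    using norm_zeta_reg_ge_near_line[OF \<delta>] by blast
  define C where "C = 248 / \<delta>\<^sup>2"
  show thesis
  proof (rule that[of \<kappa> "C / c + 32 / \<delta>"])
    fix s assume s: "\<bar>Im s\<bar> \<ge> 2" "\<bar>Re s - 1\<bar> \<le> \<kappa> * \<bar>Im s\<bar> powr (-5 * \<delta>)"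
    define t where "t = \<bar>Im s\<bar>"
    have t: "t \<ge> 2" using s by (simp add: t_def)
    have "\<kappa> * t powr (-5 * \<delta>) \<le> \<kappa>"
      using mult_powr_minus_le[of \<kappa> t "5 * \<delta>"] \<kappa>c t \<delta> by simp
    hence re: "\<bar>Re s - 1\<bar> \<le> \<delta> / 2" using s \<kappa>c unfolding t_def by linarith
    have lower: "norm (zeta_reg s) \<ge> c * t powr (1 - 4 * \<delta>)"
      unfolding t_def using s by (rule \<kappa>c)
    moreover have "c * t powr (1 - 4 * \<delta>) > 0" using \<kappa>c t by simp
    ultimately have "zeta_reg s \<noteq> 0" by auto
    have "norm (deriv zeta_reg s) \<le> C * t powr (1 + \<delta>)"
      unfolding C_def t_def using re s \<delta> by (intro norm_deriv_zeta_reg_le) linarith+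
    hence "norm (deriv zeta_reg s / zeta_reg s) \<le> (C * t powr (1 + \<delta>)) / (c * t powr (1 - 4 * \<delta>))"
      unfolding norm_divide using lower \<kappa>c t by (intro frac_le) (auto simp: C_def)
    also have "\<dots> = C / c * (t powr (1 + \<delta>) / t powr (1 - 4 * \<delta>))" by simp
    also have "t powr (1 + \<delta>) / t powr (1 - 4 * \<delta>) = t powr (5 * \<delta>)" by (simp flip: powr_diff)
    finally have log_deriv: "norm (deriv zeta_reg s / zeta_reg s) \<le> C / c * t powr (5 * \<delta>)" .
    have "norm ((zeta_reg s - 1) / (s - 1)) \<le> 32 / \<delta> * t powr \<delta>"
      unfolding t_def using re s \<delta> by (intro norm_zeta_reg_quotient_le) linarith+
    also have "\<dots> \<le> 32 / \<delta> * t powr (5 * \<delta>)" using t \<delta> by (intro mult_left_mono powr_mono) auto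
    finally have pole: "norm ((zeta_reg s - 1) / (s - 1)) \<le> 32 / \<delta> * t powr (5 * \<delta>)" .
    have "s \<noteq> 1" using s by auto
    hence "norm (mangoldt_diff s) \<le>
        norm (deriv zeta_reg s / zeta_reg s) + norm ((zeta_reg s - 1) / (s - 1))"
      using norm_triangle_ineq4[of "- (deriv zeta_reg s / zeta_reg s)"]
      by (simp add: mangoldt_diff_def)
    also have "\<dots> \<le> (C / c + 32 / \<delta>) * t powr (5 * \<delta>)"
      using log_deriv pole by (simp add: distrib_right)
    finally show "zeta_reg s \<noteq> 0 \<and> norm (mangoldt_diff s) \<le> (C / c + 32 / \<delta>) * \<bar>Im s\<bar> powr (5 * \<delta>)"
      using \<open>zeta_reg s \<noteq> 0\<close> by (simp add: t_def)
  qed (use \<kappa>c \<delta> in \<open>auto simp: C_def intro!: add_pos_pos\<close>)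
qed

lemma norm_mangoldt_diff_le_small:
  obtains \<kappa> M where "\<kappa> > 0" "M > 0"
    "\<And>s. \<bar>Im s\<bar> \<le> T \<Longrightarrow> \<bar>Re s - 1\<bar> \<le> \<kappa> \<Longrightarrow> Re s > 0 \<and> zeta_reg s \<noteq> 0 \<and> norm (mangoldt_diff s) \<le> M"
proof -
  define U where "U = {s. Re s > 0} \<inter> zeta_reg -` (-{0})"
  define S where "S = closed_segment (Complex 1 (-\<bar>T\<bar>)) (Complex 1 \<bar>T\<bar>)"
  have "open U" unfolding U_def
    by (intro continuous_open_preimage holomorphic_on_imp_continuous_on holomorphic_zeta_reg
              open_halfspace_Re_gt) auto
  moreover have "S \<subseteq> U"
    by (auto simp: S_def U_def closed_segment_same_Re zeta_reg_nonzero_Re_eq_1)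
  ultimately obtain \<kappa> where \<kappa>: "\<kappa> > 0" "(\<Union>x\<in>S. cball x \<kappa>) \<subseteq> U"
    using compact_subset_open_imp_cball_epsilon_subset[of S U] by (auto simp: S_def)
  define B where "B = cbox (Complex (1 - \<kappa>) (-\<bar>T\<bar>)) (Complex (1 + \<kappa>) \<bar>T\<bar>)"
  have "B \<subseteq> U"
  proof
    fix s assume "s \<in> B"
    hence s: "\<bar>Re s - 1\<bar> \<le> \<kappa>" "\<bar>Im s\<bar> \<le> \<bar>T\<bar>" by (auto simp: B_def in_cbox_complex_iff)
    have "Complex 1 (Im s) - s = of_real (1 - Re s)" by (simp add: complex_eq_iff)
    hence "dist (Complex 1 (Im s)) s = \<bar>1 - Re s\<bar>" by (simp only: dist_norm norm_of_real)
    hence "s \<in> cball (Complex 1 (Im s)) \<kappa>" using s by (simp add: abs_minus_commute)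
    moreover have "Complex 1 (Im s) \<in> S"
      using s by (auto simp: S_def closed_segment_same_Re closed_segment_eq_real_ivl)
    ultimately show "s \<in> U" using \<kappa> by blast
  qed
  have "mangoldt_diff holomorphic_on U"
    using \<open>open U\<close> by (rule holomorphic_mangoldt_diff) (auto simp: U_def)
  hence "bounded (mangoldt_diff ` B)"
    using \<open>B \<subseteq> U\<close> unfolding B_def
    by (intro compact_imp_bounded compact_continuous_image holomorphic_on_imp_continuous_on)
       (auto intro: holomorphic_on_subset)
  then obtain M where M: "M > 0" "\<And>s. s \<in> B \<Longrightarrow> norm (mangoldt_diff s) \<le> M"
    unfolding bounded_pos by auto
  show thesis
  proof (rule that[OF \<kappa>(1) M(1)])
    fix s assume "\<bar>Im s\<bar> \<le> T" "\<bar>Re s - 1\<bar> \<le> \<kappa>"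
    hence "s \<in> B" by (auto simp: B_def in_cbox_complex_iff)
    thus "Re s > 0 \<and> zeta_reg s \<noteq> 0 \<and> norm (mangoldt_diff s) \<le> M"
      using \<open>B \<subseteq> U\<close> M(2) by (auto simp: U_def)
  qed
qed

lemma zero_free_region:
  assumes \<theta>: "0 < \<theta>" "\<theta> \<le> 1"
  obtains \<kappa> M where "\<kappa> > 0" "\<kappa> < 1" "M > 0"
    "\<And>R s. R \<ge> 2 \<Longrightarrow> \<bar>Im s\<bar> \<le> R \<Longrightarrow> \<bar>Re s - 1\<bar> \<le> \<kappa> * R powr (-\<theta>) \<Longrightarrow>
       zeta_reg s \<noteq> 0 \<and> norm (mangoldt_diff s) \<le> M * R powr \<theta>"
proof -
  obtain \<kappa>1 M1 where large: "\<kappa>1 > 0" "\<kappa>1 \<le> \<theta> / 5 / 2" "M1 > 0"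
    "\<And>s. \<bar>Im s\<bar> \<ge> 2 \<Longrightarrow> \<bar>Re s - 1\<bar> \<le> \<kappa>1 * \<bar>Im s\<bar> powr (-5 * (\<theta> / 5)) \<Longrightarrow>
       zeta_reg s \<noteq> 0 \<and> norm (mangoldt_diff s) \<le> M1 * \<bar>Im s\<bar> powr (5 * (\<theta> / 5))"
    using norm_mangoldt_diff_le_large[of "\<theta> / 5"] \<theta> by auto
  obtain \<kappa>2 M2 where small: "\<kappa>2 > 0" "M2 > 0"
    "\<And>s. \<bar>Im s\<bar> \<le> 2 \<Longrightarrow> \<bar>Re s - 1\<bar> \<le> \<kappa>2 \<Longrightarrow> Re s > 0 \<and> zeta_reg s \<noteq> 0 \<and> norm (mangoldt_diff s) \<le> M2"
    using norm_mangoldt_diff_le_small[of 2] by metis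
  define \<kappa> M where "\<kappa> = min \<kappa>1 \<kappa>2" and "M = max M1 M2"
  have \<kappa>: "0 < \<kappa>" "\<kappa> \<le> \<kappa>1" "\<kappa> \<le> \<kappa>2" using large small by (auto simp: \<kappa>_def)
  have M: "0 < M" "M1 \<le> M" "M2 \<le> M" using large by (auto simp: M_def)
  show thesis
  proof (rule that[of \<kappa> M])
    fix R s assume R: "R \<ge> 2" and s: "\<bar>Im s\<bar> \<le> R" "\<bar>Re s - 1\<bar> \<le> \<kappa> * R powr (-\<theta>)"
    show "zeta_reg s \<noteq> 0 \<and> norm (mangoldt_diff s) \<le> M * R powr \<theta>"
    proof (cases "\<bar>Im s\<bar> \<le> 2")
      case True
      have "\<kappa> * R powr (-\<theta>) \<le> \<kappa>" using R \<kappa> \<theta> by (intro mult_powr_minus_le) auto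
      hence "\<bar>Re s - 1\<bar> \<le> \<kappa>2" using s \<kappa> by linarith
      from small(3)[OF True this] have "zeta_reg s \<noteq> 0" "norm (mangoldt_diff s) \<le> M * 1"
      using M by auto
      moreover have "M * 1 \<le> M * R powr \<theta>"
        using M R \<theta> by (intro mult_left_mono ge_one_powr_ge_zero) auto
      ultimately show ?thesis by linarith
    next
      case False
      have "\<kappa> * R powr (-\<theta>) \<le> \<kappa>1 * \<bar>Im s\<bar> powr (-\<theta>)"
        using \<kappa> s \<theta> False large by (intro mult_mono powr_mono2') auto
      hence "zeta_reg s \<noteq> 0 \<and> norm (mangoldt_diff s) \<le> M1 * \<bar>Im s\<bar> powr \<theta>"
        using large(4)[of s] s False by simp
      moreover have "M1 * \<bar>Im s\<bar> powr \<theta> \<le> M * R powr \<theta>"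
        using M s \<theta> large False by (intro mult_mono powr_mono2) auto
      ultimately show ?thesis by linarith
    qed
  qed (use \<kappa> M large \<theta> in auto)
qed

lemma
  fixes a b R :: real
  shows open_half_strip: "open {s. a < Re s \<and> \<bar>Im s\<bar> < R}"
    and convex_half_strip: "convex {s. a < Re s \<and> \<bar>Im s\<bar> < R}"
proof -
  have "{s. a < Re s \<and> \<bar>Im s\<bar> < R} = {s. Re s > a} \<inter> {s. Im s > -R} \<inter> {s. Im s < R}" by auto
  thus "open {s. a < Re s \<and> \<bar>Im s\<bar> < R}" "convex {s. a < Re s \<and> \<bar>Im s\<bar> < R}"
    by (auto intro!: open_Int convex_Int open_halfspace_Re_gt open_halfspace_Im_gt open_halfspace_Im_lt
          convex_halfspace_Re_gt convex_halfspace_Im_gt convex_halfspace_Im_lt)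
qed

lemma mangoldt_diff_half_strip:
  assumes \<theta>: "0 < \<theta>" "\<theta> \<le> 1"
  obtains \<kappa> M where "\<kappa> > 0" "\<kappa> < 1" "M > 0"
    "\<And>R. R \<ge> 2 \<Longrightarrow> mangoldt_diff holomorphic_on {s. 1 - \<kappa> * R powr (-\<theta>) < Re s \<and> \<bar>Im s\<bar> < R}"
    "\<And>R s. R \<ge> 2 \<Longrightarrow> 1 - \<kappa> * R powr (-\<theta>) \<le> Re s \<Longrightarrow> Re s \<le> 1 \<Longrightarrow> \<bar>Im s\<bar> \<le> R \<Longrightarrow>
       norm (mangoldt_diff s) \<le> M * R powr \<theta>"
proof -
  obtain \<kappa> M where \<kappa>: "\<kappa> > 0" "\<kappa> < 1" and M: "M > 0" and zero_free:
    "\<And>R s. R \<ge> 2 \<Longrightarrow> \<bar>Im s\<bar> \<le> R \<Longrightarrow> \<bar>Re s - 1\<bar> \<le> \<kappa> * R powr (-\<theta>) \<Longrightarrow>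
       zeta_reg s \<noteq> 0 \<and> norm (mangoldt_diff s) \<le> M * R powr \<theta>"
    using zero_free_region[OF \<theta>] by auto
  show thesis
  proof (rule that[OF \<kappa> M])
    fix R :: real assume R: "R \<ge> 2"
    have "\<kappa> * R powr (-\<theta>) \<le> \<kappa>" using R \<kappa> \<theta> by (intro mult_powr_minus_le) auto
    hence "\<kappa> * R powr (-\<theta>) < 1" using \<kappa> by linarith
    moreover have "zeta_reg s \<noteq> 0" if "1 - \<kappa> * R powr (-\<theta>) < Re s" "\<bar>Im s\<bar> < R" for s
    proof (cases "Re s > 1")
      case False
      thus ?thesis using zero_free[OF R, of s] that by simp
    qed (rule zeta_reg_nonzero_Re_gt_1)
    ultimately show "mangoldt_diff holomorphic_on {s. 1 - \<kappa> * R powr (-\<theta>) < Re s \<and> \<bar>Im s\<bar> < R}"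
      by (intro holomorphic_mangoldt_diff open_half_strip) auto
  next
    fix R s assume "R \<ge> 2" "1 - \<kappa> * R powr (-\<theta>) \<le> Re s" "Re s \<le> 1" "\<bar>Im s\<bar> \<le> R"
    thus "norm (mangoldt_diff s) \<le> M * R powr \<theta>" using zero_free[of R s] by simp
  qed
qed

section \<open>Newman's contour\<close>

lemma Cauchy_integral_formula_two_arcs:
  assumes "open V" "convex V" "f holomorphic_on V" "0 \<in> V" "Im w > 0"
  assumes g: "valid_path g" "path_image g \<subseteq> V - \<real>\<^sub>\<le>\<^sub>0" "pathstart g = -w" "pathfinish g = w"
  assumes h: "valid_path h" "path_image h \<subseteq> V - \<real>\<^sub>\<ge>\<^sub>0" "pathstart h = w" "pathfinish h = -w"
  shows   "contour_integral g (\<lambda>z. f z / z) + contour_integral h (\<lambda>z. f z / z) = 2 * pi * \<i> * f 0"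
proof -
  have "w \<noteq> 0" using assms(5) by auto
  hence Ln_w: "Ln w - Ln (-w) = pi * \<i>" using assms(5) by (simp add: Ln_minus)
  have "((\<lambda>z. 1 / z) has_contour_integral (Ln (pathfinish g) - Ln (pathstart g))) g"
    by (rule contour_integral_primitive[of "path_image g"])
       (use g in \<open>auto intro!: derivative_eq_intros simp: divide_inverse\<close>)
  moreover have "((\<lambda>z. 1 / z) has_contour_integral (Ln (- pathfinish h) - Ln (- pathstart h))) h"
  proof (rule contour_integral_primitive[of "path_image h"])
    fix z assume "z \<in> path_image h"
    hence "-z \<notin> \<real>\<^sub>\<le>\<^sub>0" using h(2) by (auto simp: uminus_nonpos_Reals_iff)
    thus "((\<lambda>z. Ln (-z)) has_field_derivative 1 / z) (at z within path_image h)"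
      by (auto intro!: derivative_eq_intros simp: divide_inverse)
  qed (use h in auto)
  ultimately have "((\<lambda>z. 1 / z) has_contour_integral 2 * pi * \<i>) (g +++ h)"
    using has_contour_integral_join[of "\<lambda>z. 1 / z" "pi * \<i>" g "pi * \<i>" h] g h Ln_w
    by (simp add: mult_ac)
  moreover have avoid_0: "path_image g \<subseteq> V - {0}" "path_image h \<subseteq> V - {0}" using g(2) h(2) by auto
  hence gh: "valid_path (g +++ h)" "path_image (g +++ h) \<subseteq> V - {0}"
    using g h by (auto simp: path_image_join valid_path_join)
  ultimately have "winding_number (g +++ h) 0 = 1"
    by (subst winding_number_valid_path) (auto dest!: contour_integral_unique)
  hence "((\<lambda>z. f z / z) has_contour_integral 2 * pi * \<i> * f 0) (g +++ h)"
    using Cauchy_integral_formula_convex_simple[OF assms(2,3) _ gh] assms(1,4) g h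
    by (simp add: interior_open)
  hence "contour_integral (g +++ h) (\<lambda>z. f z / z) = 2 * pi * \<i> * f 0"
    by (rule contour_integral_unique)
  moreover have "(\<lambda>z. f z / z) contour_integrable_on p"
    if "valid_path p" "path_image p \<subseteq> V - {0}" for p
    by (rule contour_integrable_holomorphic_simple[OF _ open_delete[OF assms(1)] that])
       (use assms(3) in \<open>auto intro!: holomorphic_intros intro: holomorphic_on_subset\<close>)
  hence "(\<lambda>z. f z / z) contour_integrable_on g" "(\<lambda>z. f z / z) contour_integrable_on h"
    using g h avoid_0 by auto
  ultimately show ?thesis using g h by simp
qed

definition right_half_circle :: "real \<Rightarrow> real \<Rightarrow> complex" where
  "right_half_circle R = part_circlepath 0 R (-pi/2) (pi/2)"

definition left_half_circle :: "real \<Rightarrow> real \<Rightarrow> complex" where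
  "left_half_circle R = part_circlepath 0 R (pi/2) (3*pi/2)"

definition left_rectangle_path :: "real \<Rightarrow> real \<Rightarrow> real \<Rightarrow> complex" where
  "left_rectangle_path d R = linepath (Complex 0 R) (Complex (-d) R) +++
     linepath (Complex (-d) R) (Complex (-d) (-R)) +++ linepath (Complex (-d) (-R)) (Complex 0 (-R))"

lemma valid_path_half_circle [simp]:
  "valid_path (right_half_circle R)" "valid_path (left_half_circle R)"
  by (simp_all add: right_half_circle_def left_half_circle_def)

lemma valid_path_left_rectangle_path [simp]: "valid_path (left_rectangle_path d R)"
  by (simp add: left_rectangle_path_def valid_path_join)

lemma half_circle_ends [simp]:
  "pathstart (right_half_circle R) = - Complex 0 R" "pathfinish (right_half_circle R) = Complex 0 R"
  "pathstart (left_half_circle R) = Complex 0 R" "pathfinish (left_half_circle R) = - Complex 0 R"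
  using cos_3over2_pi sin_3over2_pi
  by (simp_all add: right_half_circle_def left_half_circle_def complex_eq_iff Re_exp Im_exp)

lemma left_rectangle_path_ends [simp]:
  "pathstart (left_rectangle_path d R) = Complex 0 R"
  "pathfinish (left_rectangle_path d R) = - Complex 0 R"
  by (simp_all add: left_rectangle_path_def complex_eq_iff)

lemma path_image_right_half_circle:
  assumes "R > 0" "z \<in> path_image (right_half_circle R)"
  shows   "norm z = R \<and> Re z \<ge> 0 \<and> z \<notin> \<real>\<^sub>\<le>\<^sub>0"
proof -
  have "cos x \<ge> 0" if "-pi/2 \<le> x" "x \<le> pi/2" for x using that by (intro cos_ge_zero) auto
  hence z: "norm z = R" "Re z \<ge> 0"
    using assms
    by (auto simp: right_half_circle_def path_image_part_circlepath' closed_segment_eq_real_ivl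
                   norm_mult)
  thus ?thesis using assms(1) by (auto simp: complex_nonpos_Reals_iff cmod_eq_Re complex_eq_iff)
qed

lemma path_image_left_half_circle:
  assumes "R > 0" "z \<in> path_image (left_half_circle R)"
  shows   "norm z = R \<and> Re z \<le> 0 \<and> z \<notin> \<real>\<^sub>\<ge>\<^sub>0"
proof -
  have "cos x \<le> 0" if "pi/2 \<le> x" "x \<le> 3*pi/2" for x
    using cos_ge_zero[of "x - pi"] that by simp
  hence z: "norm z = R" "Re z \<le> 0"
    using assms
    by (auto simp: left_half_circle_def path_image_part_circlepath' closed_segment_eq_real_ivl
                   norm_mult mult_nonneg_nonpos)
  thus ?thesis using assms(1) by (auto simp: complex_nonneg_Reals_iff cmod_eq_Re complex_eq_iff)
qed

lemma left_rectangle_sides: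
  assumes "R > 0" "d > 0"
  shows   "z \<in> closed_segment (Complex 0 R) (Complex (-d) R) \<longleftrightarrow> Im z = R \<and> -d \<le> Re z \<and> Re z \<le> 0"
    and   "z \<in> closed_segment (Complex (-d) R) (Complex (-d) (-R)) \<longleftrightarrow> Re z = -d \<and> \<bar>Im z\<bar> \<le> R"
    and   "z \<in> closed_segment (Complex (-d) (-R)) (Complex 0 (-R)) \<longleftrightarrow>
             Im z = -R \<and> -d \<le> Re z \<and> Re z \<le> 0"
  using assms
  by (auto simp: closed_segment_same_Im closed_segment_same_Re closed_segment_eq_real_ivl)

lemma path_image_left_rectangle_path:
  assumes "R > 0" "d > 0" "z \<in> path_image (left_rectangle_path d R)"
  shows   "-d \<le> Re z \<and> Re z \<le> 0 \<and> \<bar>Im z\<bar> \<le> R \<and> z \<notin> \<real>\<^sub>\<ge>\<^sub>0"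
  using assms
  by (auto simp: left_rectangle_path_def path_image_join left_rectangle_sides complex_nonneg_Reals_iff)

text \<open>
  Newman's kernel with the squared factor \<open>(1 + z\<^sup>2 / R\<^sup>2)\<^sup>2\<close>, whose double zeros at \<open>z = \<plusminus>\<i>R\<close> compensate
  a bound of order \<open>1 / (Re z)\<^sup>2\<close>; such a bound needs no Chebyshev estimate for the coefficients.
\<close>
definition newman_kernel :: "real \<Rightarrow> real \<Rightarrow> complex \<Rightarrow> complex" where
  "newman_kernel T R z = exp (of_real T * z) * (1 + z ^ 2 / of_real R ^ 2) ^ 2"

lemma holomorphic_newman_kernel [holomorphic_intros]:
  assumes "R \<noteq> 0"
  shows   "newman_kernel T R holomorphic_on A"
  unfolding newman_kernel_def [abs_def] using assms by (intro holomorphic_intros) auto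

lemma newman_kernel_0 [simp]: "newman_kernel T R 0 = 1"
  by (simp add: newman_kernel_def)

lemma norm_newman_kernel_circle:
  assumes "norm z = R" "R > 0"
  shows   "norm (newman_kernel T R z) = 4 * exp (T * Re z) * (Re z)\<^sup>2 / R ^ 2"
proof -
  have "of_real (R ^ 2) = z * cnj z" using assms by (simp add: complex_norm_square [symmetric])
  hence "of_real (R ^ 2) + z ^ 2 = z * of_real (2 * Re z)"
    by (simp only: complex_add_cnj [symmetric] power2_eq_square distrib_left add.commute)
  moreover have "1 + z ^ 2 / of_real R ^ 2 = (of_real (R ^ 2) + z ^ 2) / of_real (R ^ 2)"
    using assms by (simp add: field_simps)
  ultimately have "norm (1 + z ^ 2 / of_real R ^ 2) =
      norm (z * of_real (2 * Re z) / of_real (R ^ 2))"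
    by simp
  also have "\<dots> = 2 * \<bar>Re z\<bar> / R"
    using assms by (simp add: norm_mult norm_divide norm_power power2_eq_square abs_mult)
  finally show ?thesis
    by (simp add: newman_kernel_def norm_mult norm_power power_divide power_mult_distrib)
qed

lemma norm_newman_kernel_le:
  assumes "R > 0" "\<bar>Re z\<bar> \<le> R" "\<bar>Im z\<bar> \<le> R"
  shows   "norm (newman_kernel T R z) \<le> 9 * exp (T * Re z)"
proof -
  have "norm z ^ 2 = (Re z)\<^sup>2 + (Im z)\<^sup>2" by (simp add: cmod_power2)
  also have "\<dots> \<le> R ^ 2 + R ^ 2"
    using assms by (intro add_mono; subst abs_le_square_iff [symmetric]) auto
  finally have "norm (z ^ 2 / of_real R ^ 2) \<le> 2"
    using assms by (simp add: norm_divide norm_power divide_simps)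
  hence "norm (1 + z ^ 2 / of_real R ^ 2) \<le> 3"
    using norm_triangle_ineq[of 1 "z ^ 2 / of_real R ^ 2"] by simp
  hence "norm (1 + z ^ 2 / of_real R ^ 2) ^ 2 \<le> 3 ^ 2" by (rule power_mono) auto
  thus ?thesis by (simp add: newman_kernel_def norm_mult norm_power mult.commute)
qed

definition newman_integrand :: "real \<Rightarrow> real \<Rightarrow> (complex \<Rightarrow> complex) \<Rightarrow> complex \<Rightarrow> complex" where
  "newman_integrand T R f z = f z * newman_kernel T R z / z"

lemma contour_integrable_newman_integrand:
  assumes "open V" "f holomorphic_on V" "R \<noteq> 0" "valid_path g" "path_image g \<subseteq> V - {0}"
  shows   "newman_integrand T R f contour_integrable_on g"
  unfolding newman_integrand_def [abs_def]
  by (rule contour_integrable_holomorphic_simple[OF _ open_delete[OF assms(1), of 0] assms(4,5)])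
     (use assms(2,3) in \<open>auto intro!: holomorphic_intros intro: holomorphic_on_subset\<close>)

lemma norm_newman_arc_integral_le:
  assumes "R > 0" "a \<le> b" "A \<ge> 0"
  assumes "newman_integrand T R f contour_integrable_on part_circlepath 0 R a b"
  assumes "\<And>z. z \<in> path_image (part_circlepath 0 R a b) \<Longrightarrow> Re z \<noteq> 0 \<Longrightarrow>
             norm (f z) * exp (T * Re z) * (Re z)\<^sup>2 \<le> A"
  shows   "norm (contour_integral (part_circlepath 0 R a b) (newman_integrand T R f)) \<le>
             4 * A / R ^ 2 * (b - a)"
proof -
  have "norm (contour_integral (part_circlepath 0 R a b) (newman_integrand T R f)) \<le>
      4 * A / R ^ 3 * R * (b - a)"
  proof (rule has_contour_integral_bound_part_circlepath_strong
      [OF has_contour_integral_integral[OF assms(4)], of "{Complex 0 R, Complex 0 (-R)}"])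
    fix z assume z: "z \<in> path_image (part_circlepath 0 R a b) - {Complex 0 R, Complex 0 (-R)}"
    have norm_z: "norm z = R" using z in_path_image_part_circlepath[of z 0 R a b] assms by auto
    have "Re z \<noteq> 0"
    proof
      assume "Re z = 0"
      hence "\<bar>Im z\<bar> = R" using norm_z by (simp add: cmod_eq_Im)
      thus False using z \<open>Re z = 0\<close> by (auto simp: complex_eq_iff abs_if split: if_splits)
    qed
    hence "norm (f z) * exp (T * Re z) * (Re z)\<^sup>2 \<le> A" using z by (intro assms) auto
    hence "(norm (f z) * exp (T * Re z) * (Re z)\<^sup>2) * (4 / R ^ 3) \<le> A * (4 / R ^ 3)"
      using assms by (intro mult_right_mono) auto
    moreover have "norm (newman_integrand T R f z) =
        (norm (f z) * exp (T * Re z) * (Re z)\<^sup>2) * (4 / R ^ 3)"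
      using norm_z assms(1)
      by (simp add: newman_integrand_def norm_mult norm_divide norm_newman_kernel_circle
                    power2_eq_square power3_eq_cube)
    ultimately show "norm (newman_integrand T R f z) \<le> 4 * A / R ^ 3" by (simp add: mult_ac)
  qed (use assms in auto)
  thus ?thesis using assms by (simp add: power2_eq_square power3_eq_cube)
qed

lemma norm_newman_right_half_circle_integral_le:
  assumes R: "R > 0" and int: "newman_integrand T R f contour_integrable_on right_half_circle R"
  assumes A: "\<And>z. norm z = R \<Longrightarrow> Re z > 0 \<Longrightarrow> norm (f z) * exp (T * Re z) * (Re z)\<^sup>2 \<le> A"
  shows   "norm (contour_integral (right_half_circle R) (newman_integrand T R f)) \<le>
             4 * pi * A / R ^ 2"
proof -
  have "A \<ge> 0" using R by (intro order.trans[OF _ A[of "of_real R"]]) auto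
  have "norm (contour_integral (right_half_circle R) (newman_integrand T R f)) \<le>
      4 * A / R ^ 2 * (pi/2 - (-pi/2))"
    using int path_image_right_half_circle[OF R] unfolding right_half_circle_def
    by (intro norm_newman_arc_integral_le R \<open>A \<ge> 0\<close> A) (auto simp: order_less_le)
  thus ?thesis by (simp add: mult_ac)
qed

lemma norm_newman_left_half_circle_integral_le:
  assumes R: "R > 0" and int: "newman_integrand T R f contour_integrable_on left_half_circle R"
  assumes A: "\<And>z. norm z = R \<Longrightarrow> Re z < 0 \<Longrightarrow> norm (f z) * exp (T * Re z) * (Re z)\<^sup>2 \<le> A"
  shows   "norm (contour_integral (left_half_circle R) (newman_integrand T R f)) \<le>
             4 * pi * A / R ^ 2"
proof -
  have "A \<ge> 0" using R by (intro order.trans[OF _ A[of "- of_real R"]]) auto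
  have "norm (contour_integral (left_half_circle R) (newman_integrand T R f)) \<le>
      4 * A / R ^ 2 * (3*pi/2 - pi/2)"
    using int path_image_left_half_circle[OF R] unfolding left_half_circle_def
    by (intro norm_newman_arc_integral_le R \<open>A \<ge> 0\<close> A) (auto simp: order_less_le)
  thus ?thesis by (simp add: mult_ac)
qed

lemma norm_newman_integrand_le:
  assumes "R > 0" "\<bar>Re z\<bar> \<le> R" "\<bar>Im z\<bar> \<le> R" "0 < r" "r \<le> norm z"
    "norm (f z) \<le> M" "exp (T * Re z) \<le> e"
  shows   "norm (newman_integrand T R f z) \<le> 9 * M * e / r"
proof -
  have "M \<ge> 0" using assms(6) norm_ge_zero[of "f z"] by linarith
  have "e \<ge> 0" using assms(7) exp_ge_zero[of "T * Re z"] by linarith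
  have "norm (newman_kernel T R z) \<le> 9 * exp (T * Re z)"
    using assms by (intro norm_newman_kernel_le) auto
  hence "norm (f z) * norm (newman_kernel T R z) / norm z \<le> M * (9 * e) / r"
    using assms \<open>M \<ge> 0\<close> \<open>e \<ge> 0\<close> by (intro frac_le mult_mono) auto
  thus ?thesis by (simp add: newman_integrand_def norm_mult norm_divide mult_ac)
qed

lemma norm_newman_rectangle_integral_le:
  assumes R: "R > 0" and d: "0 < d" "d \<le> R" and T: "T \<ge> 0"
  assumes int: "newman_integrand T R f contour_integrable_on left_rectangle_path d R"
  assumes M: "\<And>z. -d \<le> Re z \<Longrightarrow> Re z \<le> 0 \<Longrightarrow> \<bar>Im z\<bar> \<le> R \<Longrightarrow> norm (f z) \<le> M"
  shows   "norm (contour_integral (left_rectangle_path d R) (newman_integrand T R f)) \<le>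
             18 * M * d / R + 18 * M * R * exp (-d * T) / d"
proof -
  define I where "I = (\<lambda>a b. contour_integral (linepath a b) (newman_integrand T R f))"
  have "M \<ge> 0" using R d by (intro order.trans[OF _ M[of 0]]) auto
  have horizontal: "norm (newman_integrand T R f z) \<le> 9 * M / R"
    if "-d \<le> Re z" "Re z \<le> 0" "\<bar>Im z\<bar> = R" for z
    using norm_newman_integrand_le[of R z R f M T 1] that R T d M abs_Im_le_cmod[of z]
    by (simp add: mult_nonneg_nonpos)
  have "norm (I (Complex 0 R) (Complex (-d) R)) \<le> 9 * M / R * norm (Complex (-d) R - Complex 0 R)"
    unfolding I_def
    by (rule contour_integral_bound_linepath)
       (use int horizontal R d \<open>M \<ge> 0\<close> in
          \<open>auto simp: left_rectangle_path_def valid_path_join left_rectangle_sides\<close>)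
  moreover have "norm (I (Complex (-d) R) (Complex (-d) (-R))) \<le>
      9 * M * exp (-d * T) / d * norm (Complex (-d) (-R) - Complex (-d) R)"
    unfolding I_def
  proof (rule contour_integral_bound_linepath)
    fix z assume "z \<in> closed_segment (Complex (-d) R) (Complex (-d) (-R))"
    thus "norm (newman_integrand T R f z) \<le> 9 * M * exp (-d * T) / d"
      using d R abs_Re_le_cmod[of z]
      by (intro norm_newman_integrand_le M) (auto simp: left_rectangle_sides mult.commute)
  qed (use int R d \<open>M \<ge> 0\<close> in \<open>auto simp: left_rectangle_path_def valid_path_join\<close>)
  moreover have "norm (I (Complex (-d) (-R)) (Complex 0 (-R))) \<le>
      9 * M / R * norm (Complex 0 (-R) - Complex (-d) (-R))"
    unfolding I_def
    by (rule contour_integral_bound_linepath)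
       (use int horizontal R d \<open>M \<ge> 0\<close> in
          \<open>auto simp: left_rectangle_path_def valid_path_join left_rectangle_sides\<close>)
  moreover have "norm (Complex (-d) R - Complex 0 R) = d"
    "norm (Complex 0 (-R) - Complex (-d) (-R)) = d"
      "norm (Complex (-d) (-R) - Complex (-d) R) = 2 * R"
    using d R by (simp_all add: cmod_eq_Re cmod_eq_Im)
  moreover have "norm (x + (y + z)) \<le> norm x + norm y + norm z" for x y z :: complex
    by norm
  moreover have "contour_integral (left_rectangle_path d R) (newman_integrand T R f) =
      I (Complex 0 R) (Complex (-d) R) +
      (I (Complex (-d) R) (Complex (-d) (-R)) + I (Complex (-d) (-R)) (Complex 0 (-R)))"
    using int by (simp add: left_rectangle_path_def valid_path_join I_def)
  ultimately have "norm (contour_integral (left_rectangle_path d R) (newman_integrand T R f)) \<le>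
      9 * M / R * d + 9 * M * exp (-d * T) / d * (2 * R) + 9 * M / R * d"
    by (smt (verit))
  thus ?thesis by (simp add: algebra_simps)
qed

lemma newman_contour_formula:
  fixes T :: real
  assumes R: "R > 0" and d: "d > 0"
  assumes V: "open V" "convex V" "{z. -d \<le> Re z \<and> \<bar>Im z\<bar> \<le> R} \<subseteq> V"
  assumes F: "F holomorphic_on V" and S: "S holomorphic_on UNIV"
  defines "I \<equiv> (\<lambda>g f. contour_integral g (newman_integrand T R f))"
  shows   "2 * pi * \<i> * (F 0 - S 0) =
             I (right_half_circle R) (\<lambda>z. F z - S z) + I (left_rectangle_path d R) F -
             I (left_half_circle R) S"
proof -
  have right: "path_image (right_half_circle R) \<subseteq> V - \<real>\<^sub>\<le>\<^sub>0"
  proof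
    fix z assume "z \<in> path_image (right_half_circle R)"
    thus "z \<in> V - \<real>\<^sub>\<le>\<^sub>0"
      using path_image_right_half_circle[OF R, of z] abs_Im_le_cmod[of z] V(3) d by auto
  qed
  have left: "path_image (left_half_circle R) \<subseteq> UNIV - \<real>\<^sub>\<ge>\<^sub>0"
    using path_image_left_half_circle[OF R] by auto
  have rectangle: "path_image (left_rectangle_path d R) \<subseteq> V - \<real>\<^sub>\<ge>\<^sub>0"
    using path_image_left_rectangle_path[OF R d] V(3) by auto
  have K: "newman_kernel T R holomorphic_on A" for A using R by (intro holomorphic_intros) auto
  have Cauchy_F: "I (right_half_circle R) F + I (left_rectangle_path d R) F =
      2 * pi * \<i> * (F 0 * newman_kernel T R 0)"
    unfolding I_def newman_integrand_def [abs_def]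
    by (rule Cauchy_integral_formula_two_arcs[OF V(1,2)])
       (use V R d F K right rectangle in \<open>auto intro!: holomorphic_intros\<close>)
  have Cauchy_S: "I (right_half_circle R) S + I (left_half_circle R) S =
      2 * pi * \<i> * (S 0 * newman_kernel T R 0)"
    unfolding I_def newman_integrand_def [abs_def]
    by (rule Cauchy_integral_formula_two_arcs[OF open_UNIV convex_UNIV])
       (use R S K right left in \<open>auto intro!: holomorphic_intros\<close>)
  have "newman_integrand T R (\<lambda>z. F z - S z) =
      (\<lambda>z. newman_integrand T R F z - newman_integrand T R S z)"
    by (simp add: fun_eq_iff newman_integrand_def left_diff_distrib diff_divide_distrib)
  moreover have "path_image (right_half_circle R) \<subseteq> V - {0}"
      "path_image (right_half_circle R) \<subseteq> UNIV - {0}"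
    using right by auto
  ultimately have "I (right_half_circle R) (\<lambda>z. F z - S z) =
      I (right_half_circle R) F - I (right_half_circle R) S"
    unfolding I_def using R
    by (simp add: contour_integral_diff contour_integrable_newman_integrand[OF V(1) F]
          contour_integrable_newman_integrand[OF open_UNIV S])
  hence "I (right_half_circle R) (\<lambda>z. F z - S z) + I (left_rectangle_path d R) F -
        I (left_half_circle R) S =
      2 * pi * \<i> * (F 0 * newman_kernel T R 0) - 2 * pi * \<i> * (S 0 * newman_kernel T R 0)"
    unfolding Cauchy_F [symmetric] Cauchy_S [symmetric] by simp
  thus ?thesis by (simp add: algebra_simps)
qed

lemma newman_contour_bound:
  fixes F S :: "complex \<Rightarrow> complex" and R d T A1 A2 M :: real
  assumes R: "R > 0" and d: "0 < d" "d \<le> R" and T: "T \<ge> 0"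
  assumes V: "open V" "convex V" "{z. -d \<le> Re z \<and> \<bar>Im z\<bar> \<le> R} \<subseteq> V"
  assumes F: "F holomorphic_on V" and S: "S holomorphic_on UNIV"
  assumes right: "\<And>z. norm z = R \<Longrightarrow> Re z > 0 \<Longrightarrow> norm (F z - S z) * exp (T * Re z) * (Re z)\<^sup>2 \<le> A1"
  assumes left: "\<And>z. norm z = R \<Longrightarrow> Re z < 0 \<Longrightarrow> norm (S z) * exp (T * Re z) * (Re z)\<^sup>2 \<le> A2"
  assumes M: "\<And>z. -d \<le> Re z \<Longrightarrow> Re z \<le> 0 \<Longrightarrow> \<bar>Im z\<bar> \<le> R \<Longrightarrow> norm (F z) \<le> M"
  shows "2 * pi * norm (F 0 - S 0) \<le>
           4 * pi * (A1 + A2) / R ^ 2 + 18 * M * d / R + 18 * M * R * exp (-d * T) / d"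
proof -
  define I where "I = (\<lambda>g f. contour_integral g (newman_integrand T R f))"
  have FS: "(\<lambda>z. F z - S z) holomorphic_on V"
    by (intro holomorphic_intros F holomorphic_on_subset[OF S]) auto
  have right_V: "z \<in> V - {0}" if "z \<in> path_image (right_half_circle R)" for z
    using path_image_right_half_circle[OF R that] abs_Im_le_cmod[of z] V(3) R d by auto
  have "norm (I (right_half_circle R) (\<lambda>z. F z - S z)) \<le> 4 * pi * A1 / R ^ 2"
    unfolding I_def using right_V R
    by (intro norm_newman_right_half_circle_integral_le right
              contour_integrable_newman_integrand[OF V(1) FS]) auto
  moreover have "norm (I (left_half_circle R) S) \<le> 4 * pi * A2 / R ^ 2"
    unfolding I_def using path_image_left_half_circle[OF R, of 0] R
    by (intro norm_newman_left_half_circle_integral_le left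
              contour_integrable_newman_integrand[OF open_UNIV S]) auto
  moreover have "norm (I (left_rectangle_path d R) F) \<le>
      18 * M * d / R + 18 * M * R * exp (-d * T) / d"
    unfolding I_def
  proof (rule norm_newman_rectangle_integral_le[OF R d T _ M])
    show "newman_integrand T R F contour_integrable_on left_rectangle_path d R"
      using path_image_left_rectangle_path[OF R d(1)] V(3) R
      by (intro contour_integrable_newman_integrand[OF V(1) F]) force+
  qed
  moreover have "norm (2 * pi * \<i> * (F 0 - S 0)) \<le> norm (I (right_half_circle R) (\<lambda>z. F z - S z)) +
      norm (I (left_rectangle_path d R) F) + norm (I (left_half_circle R) S)"
    unfolding newman_contour_formula[OF R d(1) V F S, of T] I_def by norm
  ultimately have "2 * pi * norm (F 0 - S 0) \<le> 4 * pi * A1 / R ^ 2 +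
      (18 * M * d / R + 18 * M * R * exp (-d * T) / d) + 4 * pi * A2 / R ^ 2"
    by (simp add: norm_mult)
  thus ?thesis by (simp add: distrib_left add_divide_distrib)
qed

section \<open>Partial sums of Dirichlet series\<close>

definition dirichlet_partial :: "(nat \<Rightarrow> complex) \<Rightarrow> nat \<Rightarrow> complex \<Rightarrow> complex" where
  "dirichlet_partial a N s = (\<Sum>n\<le>N. a n * of_nat n powr (-s))"

lemma dirichlet_partial_1: "dirichlet_partial a N 1 = (\<Sum>n\<le>N. a n / of_nat n)"
  by (simp add: dirichlet_partial_def powr_minus divide_inverse)

lemma holomorphic_dirichlet_partial: "dirichlet_partial a N holomorphic_on A"
proof -
  have "(\<lambda>s. of_nat n powr (-s) :: complex) holomorphic_on A" for n
    by (cases "n = 0") (auto intro!: holomorphic_intros)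
  thus ?thesis unfolding dirichlet_partial_def [abs_def] by (intro holomorphic_intros)
qed

lemma sum_ln_powr_tail_le:
  assumes "x > 0" "0 < N" "N \<le> M"
  shows   "(\<Sum>n\<in>{N<..M}. (1 + ln (real n)) * real n powr (-x - 1)) \<le>
             real N powr (-x) * ((1 + ln (real N)) / x + 1 / x\<^sup>2)"
proof -
  define \<phi> where "\<phi> = (\<lambda>u. - (u powr (-x) * ((1 + ln u) / x + 1 / x\<^sup>2)))"
  have "(\<Sum>n\<in>{N<..M}. (1 + ln (real n)) * real n powr (-x - 1)) \<le> \<phi> (real M) - \<phi> (real N)"
  proof (rule sum_antimono_le_antiderivative[OF _ _ assms(3)])
    fix u assume "real N \<le> u"
    hence u: "u > 0" using assms by linarith
    have "(\<phi> has_real_derivative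
        - ((-x * u powr (-x - 1)) * ((1 + ln u) / x + 1 / x\<^sup>2) + u powr (-x) * (1 / u / x))) (at u)"
      unfolding \<phi>_def using u assms(1) by (auto intro!: derivative_eq_intros)
    also have "- ((-x * u powr (-x - 1)) * ((1 + ln u) / x + 1 / x\<^sup>2) + u powr (-x) * (1 / u / x)) =
        (1 + ln u) * u powr (-x - 1)"
      using u assms(1) by (simp add: powr_diff field_simps power2_eq_square)
    finally show "(\<phi> has_real_derivative (1 + ln u) * u powr (-x - 1)) (at u)" .
  next
    fix u v assume "real N \<le> u" "u \<le> v"
    hence uv: "1 \<le> u" "u \<le> v" using assms by linarith+
    have "ln (v / u) \<le> v / u - 1" using uv by (intro ln_le_minus_one) auto
    hence "1 + ln v \<le> (1 + ln u) + 1 * (v / u - 1)" using uv by (simp add: ln_div)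
    also have "\<dots> \<le> (1 + ln u) + (1 + ln u) * (v / u - 1)"
      using uv by (intro add_left_mono mult_right_mono) auto
    also have "\<dots> = (1 + ln u) * (v / u)" by (simp add: algebra_simps)
    finally have "(1 + ln v) * v powr (-x - 1) \<le> (1 + ln u) * (v / u) * v powr (-x - 1)"
      by (intro mult_right_mono) auto
    also have "\<dots> = (1 + ln u) / u * v powr (-x)" using uv by (simp add: powr_diff)
    also have "\<dots> \<le> (1 + ln u) / u * u powr (-x)"
      using uv assms(1) by (intro mult_left_mono powr_mono2') auto
    also have "\<dots> = (1 + ln u) * u powr (-x - 1)" using uv by (simp add: powr_diff)
    finally show "(1 + ln v) * v powr (-x - 1) \<le> (1 + ln u) * u powr (-x - 1)" .
  qed
  also have "\<dots> \<le> - \<phi> (real N)" using assms by (simp add: \<phi>_def)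
  finally show ?thesis by (simp add: \<phi>_def)
qed

lemma norm_dirichlet_partial_diff_le:
  assumes a: "\<And>n. n > 0 \<Longrightarrow> norm (a n) \<le> 1 + ln (real n)" and "N > 0" "x > 0" "x = Re s - 1"
  assumes F: "(\<lambda>n. a n * of_nat n powr (-s)) sums F"
  shows   "norm (F - dirichlet_partial a N s) \<le>
             real N powr (-x) * ((1 + ln (real N)) / x + 1 / x\<^sup>2)"
proof (rule LIMSEQ_le_const2[OF tendsto_norm])
  show "(\<lambda>M. dirichlet_partial a M s - dirichlet_partial a N s) \<longlonglongrightarrow> F - dirichlet_partial a N s"
    using F by (intro tendsto_intros) (simp add: sums_def_le dirichlet_partial_def)
  show "\<exists>M0. \<forall>M\<ge>M0. norm (dirichlet_partial a M s - dirichlet_partial a N s) \<le>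
      real N powr (-x) * ((1 + ln (real N)) / x + 1 / x\<^sup>2)"
  proof (intro exI allI impI)
    fix M assume "N \<le> M"
    have "{..M} - {..N} = {N<..M}" by auto
    hence "dirichlet_partial a M s - dirichlet_partial a N s =
        (\<Sum>n\<in>{N<..M}. a n * of_nat n powr (-s))"
      unfolding dirichlet_partial_def using \<open>N \<le> M\<close> by (subst sum_diff [symmetric]) auto
    also have "norm \<dots> \<le> (\<Sum>n\<in>{N<..M}. (1 + ln (real n)) * real n powr (-x - 1))"
      using a assms(4)
      by (intro sum_norm_le) (auto simp: norm_mult norm_of_nat_powr intro!: mult_right_mono)
    also have "\<dots> \<le> real N powr (-x) * ((1 + ln (real N)) / x + 1 / x\<^sup>2)"
      using assms \<open>N \<le> M\<close> by (intro sum_ln_powr_tail_le)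
    finally show "norm (dirichlet_partial a M s - dirichlet_partial a N s) \<le> \<dots>" .
  qed
qed

lemma norm_dirichlet_partial_le:
  assumes a: "\<And>n. n > 0 \<Longrightarrow> norm (a n) \<le> 1 + ln (real n)" and "N > 0" "y > 0" "y = 1 - Re s"
  shows   "norm (dirichlet_partial a N s) \<le>
             (1 + ln (real N)) * (real N powr y / y + real N powr (y - 1))"
proof -
  have "norm (dirichlet_partial a N s) \<le> (\<Sum>n\<le>N. (1 + ln (real N)) * real n powr (y - 1))"
    unfolding dirichlet_partial_def
  proof (rule sum_norm_le)
    fix n assume n: "n \<in> {..N}"
    have "norm (a n) \<le> 1 + ln (real N)" if "n > 0"
      using a[OF that] that n by (intro order.trans[OF a]) auto
    thus "norm (a n * of_nat n powr (-s)) \<le> (1 + ln (real N)) * real n powr (y - 1)"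
      using assms(4)
      by (cases "n = 0") (auto simp: norm_mult norm_of_nat_powr intro!: mult_right_mono)
  qed
  also have "\<dots> = (1 + ln (real N)) * (\<Sum>n\<le>N. real n powr (y - 1))" by (simp add: sum_distrib_left)
  also have "\<dots> \<le> (1 + ln (real N)) * (real N powr y / y + real N powr (y - 1))"
    using assms by (intro mult_left_mono sum_powr_le) auto
  finally show ?thesis .
qed

lemma norm_dirichlet_partial_diff_weighted_le:
  assumes "\<And>n. n > 0 \<Longrightarrow> norm (a n) \<le> 1 + ln (real n)" "N > 0" "Re z > 0" "norm z = R"
  assumes "(\<lambda>n. a n * of_nat n powr (-(1 + z))) sums F"
  shows   "norm (F - dirichlet_partial a N (1 + z)) * exp (ln (real N) * Re z) * (Re z)\<^sup>2 \<le>
             (1 + ln (real N)) * R + 1"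
proof -
  define x T where "x = Re z" and "T = ln (real N)"
  have x: "x > 0" "x \<le> R" using assms(3,4) complex_Re_le_cmod[of z] by (auto simp: x_def)
  have T: "T \<ge> 0" "real N powr (-x) = exp (-T * x)" using assms(2) by (simp_all add: T_def powr_def)
  have "norm (F - dirichlet_partial a N (1 + z)) \<le> real N powr (-x) * ((1 + T) / x + 1 / x\<^sup>2)"
    unfolding T_def using assms x by (intro norm_dirichlet_partial_diff_le) (auto simp: x_def)
  hence "norm (F - dirichlet_partial a N (1 + z)) * (exp (T * x) * x\<^sup>2) \<le>
      (exp (-T * x) * ((1 + T) / x + 1 / x\<^sup>2)) * (exp (T * x) * x\<^sup>2)"
    unfolding T(2) by (intro mult_right_mono) auto
  also have "\<dots> = (1 + T) * x + 1" using x by (simp add: exp_minus field_simps power2_eq_square)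
  also have "\<dots> \<le> (1 + T) * R + 1" using x T by (intro add_mono mult_left_mono) auto
  finally show ?thesis by (simp add: T_def x_def mult.assoc)
qed

lemma norm_dirichlet_partial_weighted_le:
  assumes "\<And>n. n > 0 \<Longrightarrow> norm (a n) \<le> 1 + ln (real n)" "N > 0" "Re z < 0" "norm z = R"
  shows   "norm (dirichlet_partial a N (1 + z)) * exp (ln (real N) * Re z) * (Re z)\<^sup>2 \<le>
             (1 + ln (real N)) * (R + R ^ 2 / real N)"
proof -
  define y T where "y = -Re z" and "T = ln (real N)"
  have y: "y > 0" "y \<le> R" using assms(3,4) abs_Re_le_cmod[of z] by (auto simp: y_def)
  have T: "T \<ge> 0" "real N powr y = exp (T * y)" using assms(2) by (simp_all add: T_def powr_def)
  have "norm (dirichlet_partial a N (1 + z)) \<le> (1 + T) * (real N powr y / y + real N powr (y - 1))"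
    unfolding T_def using assms y by (intro norm_dirichlet_partial_le) (auto simp: y_def)
  also have "\<dots> = (1 + T) * (exp (T * y) / y + exp (T * y) / real N)"
    using assms(2) by (simp add: powr_diff T(2))
  finally have "norm (dirichlet_partial a N (1 + z)) * (exp (-T * y) * y\<^sup>2) \<le>
      ((1 + T) * (exp (T * y) / y + exp (T * y) / real N)) * (exp (-T * y) * y\<^sup>2)"
    by (intro mult_right_mono) auto
  also have "\<dots> = (1 + T) * (y + y\<^sup>2 / real N)"
    using y assms(2) by (simp add: exp_minus field_simps power2_eq_square)
  also have "\<dots> \<le> (1 + T) * (R + R ^ 2 / real N)"
    using y T by (intro mult_left_mono add_mono divide_right_mono power_mono) auto
  finally show ?thesis by (simp add: T_def y_def mult.assoc)
qed

definition newman_error :: "real \<Rightarrow> real \<Rightarrow> real \<Rightarrow> real \<Rightarrow> real" where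
  "newman_error T R d M =
     4 * pi * (((1 + T) * R + 1) + (1 + T) * (R + R ^ 2 / exp T)) / R ^ 2 +
     18 * M * d / R + 18 * M * R * exp (-d * T) / d"

lemma norm_dirichlet_continuation_diff_partial_le:
  assumes a: "\<And>n. n > 0 \<Longrightarrow> norm (a n) \<le> 1 + ln (real n)"
  assumes sums: "\<And>s. Re s > 1 \<Longrightarrow> (\<lambda>n. a n * of_nat n powr (-s)) sums F s"
  assumes V: "open V" "convex V" "{s. 1 - d \<le> Re s \<and> \<bar>Im s\<bar> \<le> R} \<subseteq> V" and F: "F holomorphic_on V"
  assumes M: "\<And>s. 1 - d \<le> Re s \<Longrightarrow> Re s \<le> 1 \<Longrightarrow> \<bar>Im s\<bar> \<le> R \<Longrightarrow> norm (F s) \<le> M"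
  assumes R: "R > 0" and d: "0 < d" "d \<le> R" and N: "N > 0"
  defines "T \<equiv> ln (real N)"
  shows   "2 * pi * norm (F 1 - dirichlet_partial a N 1) \<le> newman_error T R d M"
proof -
  define W where "W = (+) (-1) ` V"
  have "open W" "convex W"
    using open_translation[OF V(1), of "-1"] convex_translation[OF V(2), of "-1"]
    by (simp_all add: W_def)
  moreover have "{z. -d \<le> Re z \<and> \<bar>Im z\<bar> \<le> R} \<subseteq> W"
  proof
    fix z assume "z \<in> {z. -d \<le> Re z \<and> \<bar>Im z\<bar> \<le> R}"
    hence "1 + z \<in> V" using V(3) by auto
    thus "z \<in> W" unfolding W_def by (intro image_eqI[of _ _ "1 + z"]) auto
  qed
  moreover have "(+) 1 ` W = V" by (simp add: W_def image_image)
  hence "(\<lambda>z. F (1 + z)) holomorphic_on W"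
    using holomorphic_on_compose[of "(+) 1" W F] F by (simp add: o_def holomorphic_intros)
  moreover have "(\<lambda>z. dirichlet_partial a N (1 + z)) holomorphic_on UNIV"
    using holomorphic_on_compose[of "\<lambda>z. 1 + z" UNIV, OF _ holomorphic_dirichlet_partial[of a N]]
    by (simp add: o_def holomorphic_intros)
  moreover have "norm (F (1 + z) - dirichlet_partial a N (1 + z)) * exp (T * Re z) * (Re z)\<^sup>2 \<le>
      (1 + T) * R + 1"
    if z: "norm z = R" "Re z > 0" for z
    unfolding T_def
    using sums[of "1 + z"] z by (intro norm_dirichlet_partial_diff_weighted_le a N) auto
  moreover have "norm (dirichlet_partial a N (1 + z)) * exp (T * Re z) * (Re z)\<^sup>2 \<le>
      (1 + T) * (R + R ^ 2 / real N)"
    if z: "norm z = R" "Re z < 0" for z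
    unfolding T_def using z by (intro norm_dirichlet_partial_weighted_le a N)
  moreover have "norm (F (1 + z)) \<le> M" if "-d \<le> Re z" "Re z \<le> 0" "\<bar>Im z\<bar> \<le> R" for z
    using that by (intro M) auto
  moreover have "T \<ge> 0" "real N = exp T" using N by (simp_all add: T_def)
  ultimately show ?thesis
    using newman_contour_bound[of R d T W "\<lambda>z. F (1 + z)" "\<lambda>z. dirichlet_partial a N (1 + z)"] R d
    by (simp add: newman_error_def)
qed

lemma norm_mangoldt_minus_1_le: "n > 0 \<Longrightarrow> norm (mangoldt n - 1 :: complex) \<le> 1 + ln (real n)"
  using norm_triangle_ineq4[of "mangoldt n :: complex" 1] mangoldt_le[of n] by simp

definition mangoldt_mean :: "nat \<Rightarrow> real" where
  "mangoldt_mean N = (\<Sum>n\<le>N. (mangoldt n - 1) / real n)"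

lemma mangoldt_mean_newman_bound:
  obtains \<kappa> M where "\<kappa> > 0" "M > 0"
    "\<And>N R. N > 0 \<Longrightarrow> R \<ge> 2 \<Longrightarrow> 2 * pi * \<bar>mangoldt_mean N - Re (mangoldt_diff 1)\<bar> \<le>
       newman_error (ln (real N)) R (\<kappa> * (R + 1) powr (-(1/4)) / 2) (M * (R + 1) powr (1/4))"
proof -
  obtain \<kappa> M where \<kappa>: "\<kappa> > 0" "\<kappa> < 1" and M: "M > 0"
    and hol: "\<And>R. R \<ge> 2 \<Longrightarrow>
       mangoldt_diff holomorphic_on {s. 1 - \<kappa> * R powr (-(1/4)) < Re s \<and> \<bar>Im s\<bar> < R}"
    and bound: "\<And>R s. R \<ge> 2 \<Longrightarrow> 1 - \<kappa> * R powr (-(1/4)) \<le> Re s \<Longrightarrow> Re s \<le> 1 \<Longrightarrow> \<bar>Im s\<bar> \<le> R \<Longrightarrow>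
       norm (mangoldt_diff s) \<le> M * R powr (1/4)"
    by (rule mangoldt_diff_half_strip[of "1/4"]) auto
  show thesis
  proof (rule that[OF \<kappa>(1) M])
    fix N :: nat and R :: real assume N: "N > 0" and R: "R \<ge> 2"
    define b where "b = \<kappa> * (R + 1) powr (-(1/4))"
    have "b \<le> \<kappa>" unfolding b_def using \<kappa> R by (intro mult_powr_minus_le) auto
    hence "b < 1" using \<kappa> by linarith
    moreover have "b > 0" using \<kappa> R by (simp add: b_def)
    ultimately have b: "0 < b" "b < 1" by simp_all
    have newman: "2 * pi * norm (mangoldt_diff 1 - dirichlet_partial (\<lambda>n. mangoldt n - 1) N 1) \<le>
        newman_error (ln (real N)) R (b / 2) (M * (R + 1) powr (1/4))"
    proof (rule norm_dirichlet_continuation_diff_partial_le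
                  [OF norm_mangoldt_minus_1_le sums_mangoldt_diff open_half_strip convex_half_strip])
      show "mangoldt_diff holomorphic_on {s. 1 - b < Re s \<and> \<bar>Im s\<bar> < R + 1}"
        unfolding b_def using R by (intro hol) auto
      show "norm (mangoldt_diff s) \<le> M * (R + 1) powr (1/4)"
        if "1 - b / 2 \<le> Re s" "Re s \<le> 1" "\<bar>Im s\<bar> \<le> R" for s
        using that b R by (intro bound) (auto simp: b_def)
    qed (use b R N in auto)
    have "dirichlet_partial (\<lambda>n. mangoldt n - 1) N 1 = of_real (mangoldt_mean N)"
      by (simp add: dirichlet_partial_1 mangoldt_mean_def)
    hence "\<bar>mangoldt_mean N - Re (mangoldt_diff 1)\<bar> \<le>
        norm (mangoldt_diff 1 - dirichlet_partial (\<lambda>n. mangoldt n - 1) N 1)"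
      using abs_Re_le_cmod[of "mangoldt_diff 1 - of_real (mangoldt_mean N)"]
      by (simp add: abs_minus_commute)
    hence "2 * pi * \<bar>mangoldt_mean N - Re (mangoldt_diff 1)\<bar> \<le>
        2 * pi * norm (mangoldt_diff 1 - dirichlet_partial (\<lambda>n. mangoldt n - 1) N 1)"
      by (intro mult_left_mono) auto
    also note newman
    finally show "2 * pi * \<bar>mangoldt_mean N - Re (mangoldt_diff 1)\<bar> \<le>
        newman_error (ln (real N)) R (\<kappa> * (R + 1) powr (-(1/4)) / 2) (M * (R + 1) powr (1/4))"
      by (simp only: b_def)
  qed
qed

lemma mangoldt_mean_asymp:
  obtains c where "(\<lambda>N. mangoldt_mean N - c) \<in> O(\<lambda>N. 1 / ln (real N) ^ 2)"
proof -
  obtain \<kappa> M where \<kappa>: "\<kappa> > 0" and M: "M > 0" and bound: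
    "\<And>N R. N > 0 \<Longrightarrow> R \<ge> 2 \<Longrightarrow> 2 * pi * \<bar>mangoldt_mean N - Re (mangoldt_diff 1)\<bar> \<le>
       newman_error (ln (real N)) R (\<kappa> * (R + 1) powr (-(1/4)) / 2) (M * (R + 1) powr (1/4))"
    using mangoldt_mean_newman_bound by blast
  define B where "B = (\<lambda>N. newman_error (ln (real N)) (ln (real N) ^ 3)
    (\<kappa> * (ln (real N) ^ 3 + 1) powr (-(1/4)) / 2) (M * (ln (real N) ^ 3 + 1) powr (1/4)))"
  have "(\<lambda>N. mangoldt_mean N - Re (mangoldt_diff 1)) \<in> O(B)"
  proof (rule bigoI[of _ "1 / (2 * pi)"])
    have "\<forall>\<^sub>F N in sequentially. ln (real N) ^ 3 \<ge> 2" by real_asymp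
    thus "\<forall>\<^sub>F N in sequentially. norm (mangoldt_mean N - Re (mangoldt_diff 1)) \<le>
        1 / (2 * pi) * norm (B N)"
      using eventually_gt_at_top[of 0]
    proof eventually_elim
      case (elim N)
      have "2 * pi * \<bar>mangoldt_mean N - Re (mangoldt_diff 1)\<bar> \<le> B N"
        unfolding B_def by (rule bound[OF elim(2,1)])
      also have "\<dots> \<le> norm (B N)" by simp
      finally show ?case by (simp add: field_simps)
    qed
  qed
  also have "B \<in> O(\<lambda>N. 1 / ln (real N) ^ 2)"
    unfolding B_def newman_error_def by (intro sum_in_bigo) (use \<kappa> M in real_asymp)+
  finally show thesis by (rule that)
qed

section \<open>The prime counting function\<close>

lemma sum_by_parts:
  fixes f g :: "nat \<Rightarrow> 'a :: comm_ring"
  shows "(\<Sum>n<N. (f (Suc n) - f n) * g (Suc n)) =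
           f N * g N - f 0 * g 0 - (\<Sum>n<N. f n * (g (Suc n) - g n))"
  by (induction N) (simp_all add: algebra_simps)

lemma sum_bigo_of_bigo_diff:
  fixes f g :: "nat \<Rightarrow> real"
  assumes f: "f \<in> O(\<lambda>n. g (Suc n) - g n)" and mono: "\<forall>\<^sub>F n in sequentially. g n \<le> g (Suc n)"
  assumes g: "filterlim g at_top sequentially"
  shows   "(\<lambda>N. \<Sum>n<N. f n) \<in> O(g)"
proof -
  obtain C where C: "C > 0" "\<forall>\<^sub>F n in sequentially. norm (f n) \<le> C * norm (g (Suc n) - g n)"
    using f by (elim landau_o.bigE)
  from C(2) mono have "\<forall>\<^sub>F n in sequentially. \<bar>f n\<bar> \<le> C * (g (Suc n) - g n)"
    by eventually_elim simp
  then obtain m where m: "\<And>n. n \<ge> m \<Longrightarrow> \<bar>f n\<bar> \<le> C * (g (Suc n) - g n)"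
    unfolding eventually_sequentially by blast
  define K where "K = (\<Sum>n<m. \<bar>f n\<bar>) + C * \<bar>g m\<bar>"
  have bound: "\<bar>\<Sum>n<N. f n\<bar> \<le> K + C * g N" if "N \<ge> m" for N
  proof -
    have "\<bar>\<Sum>n<N. f n\<bar> \<le> (\<Sum>n<N. \<bar>f n\<bar>)" by (rule sum_abs)
    also have "\<dots> = (\<Sum>n<m. \<bar>f n\<bar>) + (\<Sum>n=m..<N. \<bar>f n\<bar>)"
      using that by (simp add: sum.atLeastLessThan_concat lessThan_atLeast0)
    also have "(\<Sum>n=m..<N. \<bar>f n\<bar>) \<le> (\<Sum>n=m..<N. C * (g (Suc n) - g n))"
      by (intro sum_mono m) auto
    also have "\<dots> = C * (g N - g m)" using that by (simp add: sum_Suc_diff' flip: sum_distrib_left)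
    also have "\<dots> \<le> C * \<bar>g m\<bar> + C * g N" using C(1) by (simp add: right_diff_distrib abs_if)
    finally show ?thesis by (simp add: K_def)
  qed
  have "\<forall>\<^sub>F N in sequentially. g N \<ge> \<bar>K\<bar> + 1" using g by (simp add: filterlim_at_top)
  hence "\<forall>\<^sub>F N in sequentially. norm (\<Sum>n<N. f n) \<le> (1 + C) * norm (g N)"
    using eventually_ge_at_top[of m]
  proof eventually_elim
    case (elim N)
    show ?case using bound[OF elim(2)] elim(1) by (simp add: distrib_right)
  qed
  thus ?thesis by (rule bigoI)
qed

lemma sum_bigo_inverse_ln_cube:
  fixes f :: "nat \<Rightarrow> real"
  assumes "f \<in> O(\<lambda>n. 1 / ln (real n) ^ 3)"
  shows   "(\<lambda>N. \<Sum>n<N. f n) \<in> O(\<lambda>N. real N / ln (real N) ^ 3)"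
proof (rule sum_bigo_of_bigo_diff)
  have "(\<lambda>n. 1 / ln (real n) ^ 3)
      \<in> O(\<lambda>n. real (Suc n) / ln (real (Suc n)) ^ 3 - real n / ln (real n) ^ 3)"
    by real_asymp
  with assms show "f \<in> O(\<lambda>n. real (Suc n) / ln (real (Suc n)) ^ 3 - real n / ln (real n) ^ 3)"
    by (rule landau_o.big_trans)
qed real_asymp+

text \<open>The summand for \<open>n = 0\<close> vanishes because \<open>x / 0 = 0\<close>.\<close>
lemma sum_mangoldt_minus_1_over_ln_asymp:
  "(\<lambda>N. \<Sum>n<N. (mangoldt (Suc n) - 1) / ln (real (Suc n))) \<in> O(\<lambda>N. real N / ln (real N) ^ 3)"
proof -
  obtain c where c: "(\<lambda>N. mangoldt_mean N - c) \<in> O(\<lambda>N. 1 / ln (real N) ^ 2)"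
    by (rule mangoldt_mean_asymp)
  define g where "g = (\<lambda>n::nat. real n / ln (real n))"
  have "(\<Sum>n<N. (mangoldt (Suc n) - 1) / ln (real (Suc n))) =
      (mangoldt_mean N - c) * g N - (\<Sum>n<N. (mangoldt_mean n - c) * (g (Suc n) - g n))" for N
  proof -
    have "mangoldt_mean (Suc n) - c - (mangoldt_mean n - c) =
        (mangoldt (Suc n) - 1) / real (Suc n)" for n
      by (simp add: mangoldt_mean_def)
    hence "(mangoldt (Suc n) - 1) / ln (real (Suc n)) =
        (mangoldt_mean (Suc n) - c - (mangoldt_mean n - c)) * g (Suc n)" for n
      by (simp add: g_def del: of_nat_Suc)
    moreover have "g 0 = 0" by (simp add: g_def)
    ultimately show ?thesis using sum_by_parts[of "\<lambda>n. mangoldt_mean n - c" g N] by simp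
  qed
  moreover have "(\<lambda>N. (mangoldt_mean N - c) * g N) \<in> O(\<lambda>N. real N / ln (real N) ^ 3)"
  proof -
    have "(\<lambda>N. (mangoldt_mean N - c) * g N) \<in> O(\<lambda>N. 1 / ln (real N) ^ 2 * g N)"
      by (intro landau_o.big.mult_right c)
    also have "(\<lambda>N. 1 / ln (real N) ^ 2 * g N) = (\<lambda>N. real N / ln (real N) ^ 3)"
      by (simp add: g_def power2_eq_square power3_eq_cube)
    finally show ?thesis .
  qed
  moreover have "(\<lambda>N. \<Sum>n<N. (mangoldt_mean n - c) * (g (Suc n) - g n))
      \<in> O(\<lambda>N. real N / ln (real N) ^ 3)"
  proof (rule sum_bigo_inverse_ln_cube)
    have "(\<lambda>n. g (Suc n) - g n) \<in> O(\<lambda>n. 1 / ln (real n))" unfolding g_def by real_asymp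
    from landau_o.big.mult[OF c this]
    show "(\<lambda>n. (mangoldt_mean n - c) * (g (Suc n) - g n)) \<in> O(\<lambda>n. 1 / ln (real n) ^ 3)"
      by (simp add: power2_eq_square power3_eq_cube)
  qed
  ultimately show ?thesis by (simp only: sum_in_bigo)
qed

lemma sum_inverse_ln_asymp:
  "(\<lambda>N. (\<Sum>n<N. 1 / ln (real (Suc n))) - (real N / ln (real N) + real N / ln (real N) ^ 2))
     \<in> O(\<lambda>N. real N / ln (real N) ^ 3)"
proof -
  define g where "g = (\<lambda>n::nat. real n / ln (real n) + real n / ln (real n) ^ 2)"
  have "(\<lambda>n. 1 / ln (real (Suc n)) - (g (Suc n) - g n)) \<in> O(\<lambda>n. 1 / ln (real n) ^ 3)"
    unfolding g_def by real_asymp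
  hence "(\<lambda>N. \<Sum>n<N. 1 / ln (real (Suc n)) - (g (Suc n) - g n)) \<in> O(\<lambda>N. real N / ln (real N) ^ 3)"
    by (rule sum_bigo_inverse_ln_cube)
  moreover have "(\<Sum>n<N. 1 / ln (real (Suc n)) - (g (Suc n) - g n)) =
      (\<Sum>n<N. 1 / ln (real (Suc n))) - g N" for N
  proof -
    have "g 0 = 0" by (simp add: g_def)
    thus ?thesis by (subst sum_subtractf) (simp add: sum_lessThan_telescope)
  qed
  ultimately show ?thesis by (simp add: g_def)
qed

definition prime_count :: "nat \<Rightarrow> nat" where
  "prime_count N = card {p. prime p \<and> p \<le> N}"

lemma card_proper_primepows_le:
  assumes "N > 0"
  shows "real (card {n. primepow n \<and> \<not>prime n \<and> n \<le> N}) \<le>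
           (sqrt (real N) + 1) * (log 2 (real N) + 1)"
proof -
  define a b where "a = nat \<lfloor>sqrt (real N)\<rfloor>" and "b = nat \<lfloor>log 2 (real N)\<rfloor>"
  have "{n. primepow n \<and> \<not>prime n \<and> n \<le> N} \<subseteq> (\<lambda>(p, k). p ^ k) ` ({..a} \<times> {..b})"
  proof
    fix n assume "n \<in> {n. primepow n \<and> \<not>prime n \<and> n \<le> N}"
    hence n: "primepow n" "\<not>prime n" "n \<le> N" by auto
    then obtain p k where pk: "prime p" "k > 0" "n = p ^ k" by (auto simp: primepow_def)
    have "k \<noteq> 1" using n(2) pk(1,3) by auto
    hence k: "k \<ge> 2" using pk(2) by linarith
    have p: "p \<ge> 2" using pk(1) by (rule prime_ge_2_nat)
    have "p ^ 2 \<le> p ^ k" using p k by (intro power_increasing) auto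
    hence "real (p ^ 2) \<le> real N" using n(3) pk(3) by (simp only: of_nat_le_iff)
    hence "real p \<le> sqrt (real N)" by (simp add: real_le_rsqrt)
    hence "p \<le> a" by (simp add: a_def le_nat_floor)
    have "2 ^ k \<le> p ^ k" using p by (intro power_mono) auto
    hence "real (2 ^ k) \<le> real N" using n(3) pk(3) by (simp only: of_nat_le_iff)
    hence "real k \<le> log 2 (real N)" using assms by (simp add: le_log_iff powr_realpow)
    hence "k \<le> b" by (simp add: b_def le_nat_floor)
    with \<open>p \<le> a\<close> show "n \<in> (\<lambda>(p, k). p ^ k) ` ({..a} \<times> {..b})" using pk(3) by auto
  qed
  hence "card {n. primepow n \<and> \<not>prime n \<and> n \<le> N} \<le> card ((\<lambda>(p, k). p ^ k) ` ({..a} \<times> {..b}))"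
    by (intro card_mono) auto
  also have "\<dots> \<le> card ({..a} \<times> {..b})" by (rule card_image_le) auto
  also have "\<dots> = Suc a * Suc b" by (simp add: card_cartesian_product)
  finally have "real (card {n. primepow n \<and> \<not>prime n \<and> n \<le> N}) \<le> real (Suc a * Suc b)"
    by (simp only: of_nat_le_iff)
  also have "\<dots> \<le> (sqrt (real N) + 1) * (log 2 (real N) + 1)"
    unfolding of_nat_mult using assms by (intro mult_mono) (auto simp: a_def b_def)
  finally show ?thesis .
qed

lemma sum_mangoldt_over_ln_eq:
  "(\<Sum>n\<le>N. mangoldt n / ln (real n)) =
     real (prime_count N) + (\<Sum>n | primepow n \<and> \<not>prime n \<and> n \<le> N. mangoldt n / ln (real n))"
proof -
  define A B where "A = {p. prime p \<and> p \<le> N}" and "B = {n. primepow n \<and> \<not>prime n \<and> n \<le> N}"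
  have "(\<Sum>n\<le>N. mangoldt n / ln (real n)) = (\<Sum>n\<in>A \<union> B. mangoldt n / ln (real n))"
    by (intro sum.mono_neutral_right) (auto simp: A_def B_def mangoldt_def)
  also have "\<dots> = (\<Sum>n\<in>A. mangoldt n / ln (real n)) + (\<Sum>n\<in>B. mangoldt n / ln (real n))"
    by (intro sum.union_disjoint) (auto simp: A_def B_def)
  also have "(\<Sum>n\<in>A. mangoldt n / ln (real n)) = (\<Sum>n\<in>A. 1)"
    by (intro sum.cong refl) (auto simp: A_def dest: prime_gt_1_nat)
  finally show ?thesis by (simp add: A_def B_def prime_count_def)
qed

lemma sum_mangoldt_over_ln_minus_prime_count_le:
  assumes "N > 0"
  shows "\<bar>(\<Sum>n\<le>N. mangoldt n / ln (real n)) - real (prime_count N)\<bar> \<le>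
           (sqrt (real N) + 1) * (log 2 (real N) + 1)"
proof -
  define B where "B = {n. primepow n \<and> \<not>prime n \<and> n \<le> N}"
  have "0 \<le> mangoldt n / ln (real n)" "mangoldt n / ln (real n) \<le> 1" if "n \<in> B" for n
    using that primepow_gt_Suc_0[of n] mangoldt_le[of n] mangoldt_nonneg[of n]
    by (simp_all add: B_def)
  hence "0 \<le> (\<Sum>n\<in>B. mangoldt n / ln (real n))"
    "(\<Sum>n\<in>B. mangoldt n / ln (real n)) \<le> real (card B) * 1"
    by (intro sum_nonneg sum_bounded_above; simp)+
  thus ?thesis
    using card_proper_primepows_le[OF assms] by (simp add: sum_mangoldt_over_ln_eq B_def)
qed

lemma prime_count_asymp:
  "(\<lambda>N. real (prime_count N) - (real N / ln (real N) + real N / ln (real N) ^ 2))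
     \<in> O(\<lambda>N. real N / ln (real N) ^ 3)"
proof -
  define E where "E = (\<lambda>N. (\<Sum>n\<le>N. mangoldt n / ln (real n)) - real (prime_count N))"
  have "E \<in> O(\<lambda>N. (sqrt (real N) + 1) * (log 2 (real N) + 1))"
    unfolding E_def
    by (intro bigoI[of _ 1] eventually_mono[OF eventually_gt_at_top[of 0]])
       (use sum_mangoldt_over_ln_minus_prime_count_le in fastforce)
  also have "(\<lambda>N. (sqrt (real N) + 1) * (log 2 (real N) + 1)) \<in> O(\<lambda>N. real N / ln (real N) ^ 3)"
    by real_asymp
  finally have "(\<lambda>N. (\<Sum>n<N. (mangoldt (Suc n) - 1) / ln (real (Suc n))) +
      ((\<Sum>n<N. 1 / ln (real (Suc n))) - (real N / ln (real N) + real N / ln (real N) ^ 2)) - E N)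
      \<in> O(\<lambda>N. real N / ln (real N) ^ 3)"
    by (intro sum_in_bigo sum_mangoldt_minus_1_over_ln_asymp sum_inverse_ln_asymp)
  moreover have "(\<Sum>n\<le>N. mangoldt n / ln (real n)) =
      (\<Sum>n<N. (mangoldt (Suc n) - 1) / ln (real (Suc n))) +
      (\<Sum>n<N. 1 / ln (real (Suc n)))" for N
    by (simp add: sum.atMost_shift diff_divide_distrib sum_subtractf)
  ultimately show ?thesis by (simp add: E_def algebra_simps)
qed

text \<open>The limit is known as Legendre's constant.\<close>
lemma ln_minus_over_prime_count_tendsto:
  "(\<lambda>N. ln (real N) - real N / real (prime_count N)) \<longlonglongrightarrow> 1"
proof -
  define r where "r = (\<lambda>N. real (prime_count N) - (real N / ln (real N) + real N / ln (real N) ^ 2))"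
  have r: "r \<in> O(\<lambda>N. real N / ln (real N) ^ 3)" unfolding r_def by (rule prime_count_asymp)
  have "(\<lambda>N. real N / ln (real N) ^ 2 + r N) \<in> o(\<lambda>N. real N / ln (real N))"
    by (intro sum_in_smallo landau_o.big_small_trans[OF r]) real_asymp+
  hence count: "(\<lambda>N. real (prime_count N)) \<sim>[at_top] (\<lambda>N. real N / ln (real N))"
    by (intro smallo_imp_asymp_equiv) (simp add: r_def)
  have "(\<lambda>N. ln (real N) * r N) \<in> O(\<lambda>N. ln (real N) * (real N / ln (real N) ^ 3))"
    by (intro landau_o.big.mult_left r)
  also have "(\<lambda>N. ln (real N) * (real N / ln (real N) ^ 3)) \<in> o(\<lambda>N. real N / ln (real N))"
    by real_asymp
  finally have "(\<lambda>N. (real N / ln (real N) + ln (real N) * r N) - real N / ln (real N))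
      \<in> o(\<lambda>N. real N / ln (real N))"
    by simp
  hence "(\<lambda>N. real N / ln (real N) + ln (real N) * r N) \<sim>[at_top] (\<lambda>N. real N / ln (real N))"
    by (rule smallo_imp_asymp_equiv)
  hence "(\<lambda>N. real N / ln (real N) + ln (real N) * r N) \<sim>[at_top] (\<lambda>N. real (prime_count N))"
    using count by (metis asymp_equiv_sym asymp_equiv_trans)
  moreover have pos: "\<forall>\<^sub>F N in at_top. prime_count N > 0"
    using eventually_ge_at_top[of 2]
  proof eventually_elim
    case (elim N)
    thus ?case unfolding prime_count_def by (auto simp: card_gt_0_iff intro!: exI[of _ 2])
  qed
  ultimately have "(\<lambda>N. (real N / ln (real N) + ln (real N) * r N) / real (prime_count N)) \<longlonglongrightarrow> 1"
    by (intro asymp_equivD_strong) (auto elim: eventually_mono)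
  moreover have "\<forall>\<^sub>F N in at_top. (real N / ln (real N) + ln (real N) * r N) / real (prime_count N) =
      ln (real N) - real N / real (prime_count N)"
    using pos eventually_gt_at_top[of 1]
    by eventually_elim (simp add: r_def field_simps power2_eq_square)
  ultimately show ?thesis by (rule Lim_transform_eventually)
qed

section \<open>The \<open>n\<close>-th prime\<close>

lemma prime_count_nth_prime:
  assumes "n \<ge> 1"
  shows   "prime_count (nth_prime n) = n"
proof -
  define e where "e = enumerate {p::nat. prime p}"
  have mono: "strict_mono e" unfolding e_def by (rule strict_mono_enumerate[OF primes_infinite])
  have "range e = {p. prime p}" unfolding e_def by (rule range_enumerate[OF primes_infinite])
  hence "{p. prime p \<and> p \<le> nth_prime n} = {p \<in> range e. p \<le> e (n - 1)}"
    by (simp add: nth_prime_def e_def)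
  also have "\<dots> = e ` {m. e m \<le> e (n - 1)}" by auto
  also have "{m. e m \<le> e (n - 1)} = {..<n}" using assms by (auto simp: strict_mono_less_eq[OF mono])
  finally have "{p. prime p \<and> p \<le> nth_prime n} = e ` {..<n}" .
  moreover have "inj_on e {..<n}" by (rule strict_mono_imp_inj_on[OF mono])
  ultimately show ?thesis by (simp add: prime_count_def card_image)
qed

lemma filterlim_nth_prime: "filterlim nth_prime at_top at_top"
proof (rule filterlim_at_top_mono)
  show "filterlim (\<lambda>n::nat. n - 1) at_top at_top" by (rule filterlim_minus_const_nat_at_top)
  show "\<forall>\<^sub>F n in at_top. n - 1 \<le> nth_prime n"
    by (simp add: nth_prime_def le_enumerate[OF primes_infinite])
qed

lemma ln_nth_prime_minus_quotient_tendsto: "(\<lambda>n. ln (nth_prime n) - nth_prime n / real n) \<longlonglongrightarrow> 1"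
proof (rule Lim_transform_eventually)
  show "(\<lambda>n. ln (nth_prime n) - nth_prime n / prime_count (nth_prime n)) \<longlonglongrightarrow> 1"
    by (rule filterlim_compose[OF ln_minus_over_prime_count_tendsto filterlim_nth_prime])
  show "\<forall>\<^sub>F n in at_top. ln (nth_prime n) - nth_prime n / prime_count (nth_prime n) =
      ln (nth_prime n) - nth_prime n / real n"
    by (rule eventually_mono[OF eventually_ge_at_top[of 1]]) (simp add: prime_count_nth_prime)
qed

lemma minus_lambert_Wm1_less_iff:
  assumes "v \<ge> 1" "0 < y" "y \<le> exp (-1)"
  shows   "- lambert_Wm1 (-y) < v \<longleftrightarrow> v * exp (-v) < y"
    and   "v < - lambert_Wm1 (-y) \<longleftrightarrow> y < v * exp (-v)"
proof -
  define w where "w = - lambert_Wm1 (-y)"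
  have w: "w \<ge> 1" "y = w * exp (-w)" using lambert_Wm1[of "-y"] assms by (auto simp: w_def)
  have antimono: "b * exp (-b) < a * exp (-a)" if "1 \<le> a" "a < b" for a b :: real
    using x_exp_strict_antimono[of "-b" "-a"] that by simp
  show "- lambert_Wm1 (-y) < v \<longleftrightarrow> v * exp (-v) < y" "v < - lambert_Wm1 (-y) \<longleftrightarrow> y < v * exp (-v)"
    using antimono[of v w] antimono[of w v] w assms(1) unfolding w_def [symmetric]
    by (cases v w rule: linorder_cases; force)+
qed

text \<open>
  For \<open>w = - lambert_Wm1 (- (exp b / a))\<close>, the number \<open>a * w\<close> is the larger solution \<open>X\<close> of
  \<open>ln X - X / a = b\<close>.
\<close>
lemma mult_lambert_Wm1_less_iff:
  fixes a b p :: real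
  assumes "p > 0" "exp (b + 1) \<le> a" "ln p \<ge> b + 1"
  shows   "- a * lambert_Wm1 (- (exp b / a)) < p \<longleftrightarrow> ln p - p / a < b"
    and   "p < - a * lambert_Wm1 (- (exp b / a)) \<longleftrightarrow> b < ln p - p / a"
proof -
  have a: "a > 0" using assms(2) exp_gt_zero[of "b + 1"] by linarith
  define v y w where "v = ln p - b" and "y = exp b / a" and "w = - lambert_Wm1 (-y)"
  have y: "0 < y" "y \<le> exp (-1)"
    using assms(2) a by (auto simp: y_def exp_add exp_minus field_simps)
  have v: "v \<ge> 1" "p = exp (v + b)" using assms by (auto simp: v_def)
  hence v_exp: "a * v = p * (v * exp (-v) / y)"
    using a by (simp add: y_def exp_add exp_minus field_simps)
  have "w * exp (-w) = y" using lambert_Wm1(2)[of "-y"] y by (simp add: w_def)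
  hence w_exp: "a * w = exp (w + b)" using a by (simp add: y_def exp_add exp_minus field_simps)
  have "a * w < p \<longleftrightarrow> w < v" "p < a * w \<longleftrightarrow> v < w" unfolding w_exp v(2) by simp_all
  moreover have "a * v < p \<longleftrightarrow> v * exp (-v) < y" "p < a * v \<longleftrightarrow> y < v * exp (-v)"
    unfolding v_exp using y assms(1) by (simp_all add: field_simps)
  moreover have "a * v < p \<longleftrightarrow> ln p - p / a < b" "p < a * v \<longleftrightarrow> b < ln p - p / a"
    using a by (auto simp: v_def field_simps)
  ultimately show "- a * lambert_Wm1 (- (exp b / a)) < p \<longleftrightarrow> ln p - p / a < b"
    "p < - a * lambert_Wm1 (- (exp b / a)) \<longleftrightarrow> b < ln p - p / a"
    using minus_lambert_Wm1_less_iff[OF v(1) y] by (simp_all add: w_def y_def)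
qed

theorem theorem9:
  fixes \<epsilon> :: real
  assumes "\<epsilon> > 0"
  shows "\<exists>M::nat. \<forall>n\<ge>M.
           - real n * lambert_Wm1 (- (exp (1 - \<epsilon>) / real n)) > real (nth_prime n) \<and>
           real (nth_prime n) > - (real n - 1) * lambert_Wm1 (- (exp (1 + \<epsilon>) / (real n - 1)))"
proof -
  have upper: "\<forall>\<^sub>F n in sequentially. ln (nth_prime n) - nth_prime n / real n > 1 - \<epsilon>"
    and lower: "\<forall>\<^sub>F n in sequentially. ln (nth_prime n) - nth_prime n / real n < 1 + \<epsilon>"
    using assms by (auto intro: order_tendstoD[OF ln_nth_prime_minus_quotient_tendsto])
  have "\<forall>\<^sub>F N::nat in at_top. ln N \<ge> 2 + \<epsilon>" by real_asymp
  hence large: "\<forall>\<^sub>F n in sequentially. ln (nth_prime n) \<ge> 2 + \<epsilon>"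
    by (rule eventually_compose_filterlim[OF _ filterlim_nth_prime])
  have "\<forall>\<^sub>F n::nat in sequentially. real n - 1 \<ge> exp (2 + \<epsilon>)" by real_asymp
  with upper lower large have "\<forall>\<^sub>F n in sequentially.
           - real n * lambert_Wm1 (- (exp (1 - \<epsilon>) / real n)) > real (nth_prime n) \<and>
           real (nth_prime n) > - (real n - 1) * lambert_Wm1 (- (exp (1 + \<epsilon>) / (real n - 1)))"
  proof eventually_elim
    case (elim n)
    define p where "p = real (nth_prime n)"
    have p: "p > 0" using elim(3) assms by (cases "nth_prime n = 0") (auto simp: p_def)
    have n: "real n - 1 > 0" using elim(4) exp_gt_zero[of "2 + \<epsilon>"] by linarith
    have "p / real n \<le> p / (real n - 1)" using n p by (intro divide_left_mono) auto
    hence "ln p - p / (real n - 1) < 1 + \<epsilon>" using elim(2) by (simp add: p_def)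
    moreover have "exp (1 - \<epsilon> + 1) \<le> real n"
      using elim(4) assms exp_le_cancel_iff[of "1 - \<epsilon> + 1" "2 + \<epsilon>"] by linarith
    ultimately show ?case
      using elim assms p unfolding p_def [symmetric]
      by (intro conjI; subst mult_lambert_Wm1_less_iff) auto
  qed
  thus ?thesis by (simp add: eventually_sequentially)
qed

end
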